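(* Let $d\ge 1$ be an integer. There exists a constant $C_d>0$ such that for every $u\in L^2(\mathbb{T}^d)$, $$\Vert b_u\Vert_{l^{d+1}(\mathbb{Z}^{d+1})}\le C_d\,\Vert u\Vert_{L^2(\mathbb{T}^d)}^2,$$ where $b_u(l,s)$, $(l,s)\in\mathbb{Z}^d\times\mathbb{Z}$, are the space-time Fourier coefficients of $|e^{it\Delta}u(x)|^2$, i.e. $$|e^{it\Delta}u(x)|^2=\sum_{(l,s)\in\mathbb{Z}^d\times\mathbb{Z}}b_u(l,s)\,e^{i(l\cdot x+st)}.$$
   Context: $\mathbb{T}^d:=\mathbb{R}^d/2\pi\mathbb{Z}^d$ and $\mathbb{T}:=\mathbb{R}/2\pi\mathbb{Z}$. For $u\in L^2(\mathbb{T}^d)$, $\psi(x,t)=e^{it\Delta}u(x)$ denotes the solution of $i\partial_t\psi+\Delta\psi=0$, $\psi(\cdot,0)=u$; explicitly, if $u(x)=\sum_{k\in\mathbb{Z}^d}a_ke^{ik\cdot x}$ then $e^{it\Delta}u(x)=\sum_{k\in\mathbb{Z}^d}a_ke^{i(k\cdot x-|k|^2t)}$, which is $2\pi$-periodic in $t$. The function $|e^{it\Delta}u|^2$ is continuous in $t\in\mathbb{T}$ with values in $L^1(\mathbb{T}^d)$, and its Fourier coefficients are $b_u(l,s)=\sum_{k-j=l,\ |j|^2-|k|^2=s}a_k\overline{a_j}$ (sum over $k,j\in\mathbb{Z}^d$; equal to $0$ if the range of the sum is empty). The $L^2$-norm is normalized by $\Vert u\Vert_{L^2(\mathbb{T}^d)}^2=\sum_{k}|a_k|^2=\int_{\mathbb{T}^d}|u(x)|^2\frac{dx}{(2\pi)^d}$.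 For $p\geq 1$, $\Vert b\Vert_{l^p(\mathbb{Z}^{d+1})}=\big(\sum_{(l,s)\in\mathbb{Z}^{d+1}}|b(l,s)|^p\big)^{1/p}$. *)

theory Defs
  imports "HOL-Analysis.Analysis"
begin

text \<open>
  Functions on the torus are functions on Euclidean space that are \<open>2\<pi>\<close>-periodic in every
  coordinate; integrals over the torus are integrals over the fundamental domain
  \<open>[0, 2\<pi>]\<^sup>d\<close> against Lebesgue measure normalised to total mass 1. The type \<open>'a\<close> is
  \<open>real ^ 'd\<close> for the space variable and \<open>real\<close> for the time variable.
\<close>

definition torus :: "'a::euclidean_space measure" where
  "torus = uniform_measure lebesgue (cbox 0 ((2 * pi) *\<^sub>R One))"

definition torus_periodic :: "('a::euclidean_space \<Rightarrow> 'b) \<Rightarrow> bool" where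
  "torus_periodic f \<longleftrightarrow> (\<forall>x. \<forall>b\<in>Basis. f (x + (2 * pi) *\<^sub>R b) = f x)"

text \<open>Elements of \<open>L\<^sup>2\<close> are represented by functions; no quotient by null sets is taken.\<close>

definition L2_torus :: "('a::euclidean_space \<Rightarrow> complex) set" where
  "L2_torus = {f. torus_periodic f \<and> f \<in> borel_measurable torus \<and>
                  integrable torus (\<lambda>x. (cmod (f x))\<^sup>2)}"

definition L2_norm :: "('a::euclidean_space \<Rightarrow> complex) \<Rightarrow> real" where
  "L2_norm f = sqrt (LINT x|torus. (cmod (f x))\<^sup>2)"

definition freq_inner :: "int ^ 'd \<Rightarrow> real ^ 'd \<Rightarrow> real" where
  "freq_inner k x = (\<Sum>i\<in>UNIV. of_int (k $ i) * x $ i)"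

definition freq_norm_sq :: "int ^ 'd \<Rightarrow> int" where
  "freq_norm_sq k = (\<Sum>i\<in>UNIV. (k $ i)\<^sup>2)"

definition fourier_coeff :: "(real ^ 'd \<Rightarrow> complex) \<Rightarrow> int ^ 'd \<Rightarrow> complex" where
  "fourier_coeff f k = (LINT x|torus. f x * cis (- freq_inner k x))"

text \<open>
  The solution at time \<open>t\<close> is the \<open>L\<^sup>2\<close>-sum of the (unconditionally convergent) series
  \<open>\<Sum>k. a\<^sub>k e\<^bsup>i(k\<cdot>x - |k|\<^sup>2t)\<^esup>\<close>, where \<open>a\<^sub>k\<close> are the Fourier coefficients of \<open>u\<close>. It is
  determined up to a null set for each \<open>t\<close>; \<open>SOME\<close> picks a representative.
\<close>

definition schroedinger_flow ::
    "real \<Rightarrow> (real ^ 'd \<Rightarrow> complex) \<Rightarrow> real ^ 'd \<Rightarrow> complex" where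
  "schroedinger_flow t u = (SOME v. v \<in> L2_torus \<and>
     ((\<lambda>F. L2_norm (\<lambda>x. v x -
            (\<Sum>k\<in>F. fourier_coeff u k * cis (freq_inner k x - of_int (freq_norm_sq k) * t))))
       \<longlongrightarrow> 0) (finite_subsets_at_top UNIV))"

text \<open>
  \<open>|e\<^bsup>it\<Delta>\<^esup>u|\<^sup>2\<close> is a continuous function of \<open>t\<close> with values in \<open>L\<^sup>1\<close> of the torus, so its space-time
  Fourier coefficients are iterated integrals (space first), independent of the
  representative chosen for each \<open>t\<close>.
\<close>

definition spacetime_coeff :: "(real ^ 'd \<Rightarrow> complex) \<Rightarrow> (int ^ 'd) \<times> int \<Rightarrow> complex" where
  "spacetime_coeff u = (\<lambda>(l, s).
     LINT t|torus.
       fourier_coeff (\<lambda>x. of_real ((cmod (schroedinger_flow t u x))\<^sup>2)) l * cis (- (of_int s * t)))"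

definition lp_summable :: "real \<Rightarrow> ('i \<Rightarrow> complex) \<Rightarrow> bool" where
  "lp_summable p b \<longleftrightarrow> (\<lambda>n. cmod (b n) powr p) summable_on UNIV"

text \<open>Only meaningful for \<open>lp_summable\<close> families: \<open>infsum\<close> is 0 on divergent ones.\<close>

definition lp_norm :: "real \<Rightarrow> ('i \<Rightarrow> complex) \<Rightarrow> real" where
  "lp_norm p b = (\<Sum>\<^sub>\<infinity>n. cmod (b n) powr p) powr (1 / p)"

end

theory Submission
  imports Defs
begin

text \<open>
  Write \<open>a\<^sub>k\<close> for the Fourier coefficients of \<open>u\<close> and \<open>d\<close> for the dimension. The coefficient
  \<open>b(l, s)\<close> is the sum of \<open>a\<^sub>k\<close> times the conjugate of \<open>a\<^bsub>k-l\<^esub>\<close> over the \<open>k\<close> with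
  \<open>|k - l|\<^sup>2 - |k|\<^sup>2 = s\<close>. This condition is the linear equation \<open>2 k \<bullet> l = |l|\<^sup>2 - s\<close>: for
  \<open>l \<noteq> 0\<close> the sum runs over the lattice points of a hyperplane orthogonal to \<open>l\<close>.

  Expand the \<open>(d+1)\<close>-st power of the sum of \<open>|a\<^sub>k| |a\<^bsub>k-l\<^esub>|\<close> over such a hyperplane into a sum
  over tuples \<open>k\<^sub>0, \<dots>, k\<^sub>d\<close>, and let \<open>j\<^sub>i = k\<^sub>i - l\<close>. The \<open>d\<close> differences \<open>k\<^sub>i - k\<^sub>0\<close> lie in the
  \<open>(d-1)\<close>-dimensional space orthogonal to \<open>l\<close>, so for some \<open>1 \<le> m \<le> d\<close> the difference
  \<open>k\<^sub>m - k\<^sub>0\<close> lies in the span \<open>W\<close> of the earlier ones (lemma \<open>dependent_step_exists\<close>). Fix \<open>m\<close>.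
  Then the tuple in which only \<open>k\<^sub>m\<close> is replaced by \<open>j\<^sub>m\<close> remembers everything: its entries before
  position \<open>m\<close> give \<open>W\<close>, and \<open>k\<^sub>0 - j\<^sub>m\<close> is \<open>l\<close> up to an element of \<open>W\<close>, while \<open>l\<close> is orthogonal
  to \<open>W\<close>; so \<open>l\<close>, \<open>k\<^sub>m\<close> and \<open>s\<close> are recovered. The same holds for the complementary tuple, in
  which every \<open>k\<^sub>i\<close> except \<open>k\<^sub>m\<close> is replaced by \<open>j\<^sub>i\<close>. Give a tuple the product of the \<open>|a|\<close>
  at its entries as weight. A term of the expansion is the product of the weights of its two
  tuples, hence at most half the sum of their squares; by injectivity each of the two squares
  sums to at most \<open>(\<Sum>|a\<^sub>k|\<^sup>2)\<^bsup>d+1\<^esup>\<close>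
  (lemma \<open>sum_dep_configs_le\<close>). The \<open>d\<close> values of \<open>m\<close>, together with the only possibly nonzero
  coefficient \<open>b(0, 0)\<close> for \<open>l = 0\<close>, give the \<open>(d+1)\<close>-st power of the norm the bound
  \<open>(d + 1) (\<Sum>|a\<^sub>k|\<^sup>2)\<^bsup>d+1\<^esup>\<close> (lemma \<open>sum_resonant_le\<close>), and Bessel's inequality concludes.

  The remaining work identifies \<open>b(l, s)\<close> with the sum above (theorem
  \<open>has_sum_spacetime_coeff\<close>). The Riesz-Fischer theorem produces the solution at time \<open>t\<close>.
  Continuity of the inner product gives the space coefficients of its squared modulus as an
  absolutely convergent series whose terms depend on \<open>t\<close> only through a phase, and this series
  is integrated in time term by term.
\<close>

section \<open>Sums over resonant frequencies\<close>

definition real_vec :: "int ^ 'd \<Rightarrow> real ^ 'd" where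
  "real_vec k = (\<chi> i. of_int (k $ i))"

lemma real_vec_diff: "real_vec (k - l) = real_vec k - real_vec l"
  by (simp add: real_vec_def vec_eq_iff)

lemma real_vec_eq_iff [simp]: "real_vec k = real_vec l \<longleftrightarrow> k = l"
  by (simp add: real_vec_def vec_eq_iff)

lemma real_vec_eq_0_iff [simp]: "real_vec k = 0 \<longleftrightarrow> k = 0"
  by (simp add: real_vec_def vec_eq_iff)

lemma freq_norm_sq_eq_inner: "of_int (freq_norm_sq k) = real_vec k \<bullet> real_vec k"
  by (simp add: freq_norm_sq_def real_vec_def inner_vec_def power2_eq_square)

text \<open>
  For \<open>l \<noteq> 0\<close> these are the points of \<open>F\<close> on the hyperplane \<open>2 k \<bullet> l = |l|\<^sup>2 - s\<close>. They are the
  \<open>k\<close> for which the pair \<open>(k, k - l)\<close> contributes to the space-time coefficient at \<open>(l, s)\<close>.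
\<close>
definition resonant :: "(int ^ 'd) set \<Rightarrow> int ^ 'd \<Rightarrow> int \<Rightarrow> (int ^ 'd) set" where
  "resonant F l s = {k \<in> F. freq_norm_sq (k - l) - freq_norm_sq k = s}"

lemma resonant_orthogonal:
  assumes "k \<in> resonant F l s" "k' \<in> resonant F l s"
  shows "real_vec l \<bullet> real_vec (k - k') = 0"
proof -
  have "freq_norm_sq (k - l) - freq_norm_sq k = freq_norm_sq (k' - l) - freq_norm_sq k'"
    using assms by (simp add: resonant_def)
  then have "real_of_int (freq_norm_sq (k - l) - freq_norm_sq k)
      = of_int (freq_norm_sq (k' - l) - freq_norm_sq k')" by simp
  then show ?thesis
    by (simp add: freq_norm_sq_eq_inner real_vec_diff algebra_simps inner_commute)
qed

lemma eq_of_orthogonal_of_diff_mem: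
  fixes x y :: "'a::real_inner"
  assumes "\<And>w. w \<in> W \<Longrightarrow> x \<bullet> w = 0" "\<And>w. w \<in> W \<Longrightarrow> y \<bullet> w = 0" "x - y \<in> W"
  shows "x = y"
proof -
  have "(x - y) \<bullet> (x - y) = 0"
    using assms by (simp add: inner_diff_left)
  then show ?thesis by simp
qed

text \<open>
  Otherwise each of \<open>v 1, \<dots>, v d\<close> would raise the dimension of the span by one, which gives
  dimension \<open>d\<close> inside the hyperplane orthogonal to \<open>l\<close>.
\<close>
lemma dependent_step_exists:
  fixes v :: "nat \<Rightarrow> 'a::euclidean_space"
  assumes "l \<noteq> 0" "v 0 = 0" "\<And>i. i \<le> DIM('a) \<Longrightarrow> l \<bullet> v i = 0"
  shows "\<exists>m\<in>{1..DIM('a)}. v m \<in> span (v ` {..<m})"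
proof (rule ccontr)
  assume "\<not> ?thesis"
  then have contra: "\<forall>m\<in>{1..DIM('a)}. v m \<notin> span (v ` {..<m})" by simp
  have "dim (v ` {..m}) = m" if "m \<le> DIM('a)" for m
    using that
  proof (induction m)
    case 0
    then show ?case using assms(2) by (simp add: dim_insert)
  next
    case (Suc m)
    then have "v (Suc m) \<notin> span (v ` {..m})"
      using bspec[OF contra, of "Suc m"]
      by (simp add: lessThan_Suc_atMost)
    with Suc show ?case
      by (simp add: atMost_Suc dim_insert)
  qed
  from this[of "DIM('a)"] have "DIM('a) = dim (v ` {..DIM('a)})" by simp
  also have "\<dots> \<le> dim {x. l \<bullet> x = 0}"
    by (rule dim_subset) (use assms(3) in auto)
  also have "\<dots> = DIM('a) - 1"
    by (rule dim_hyperplane[OF assms(1)])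
  finally show False
    using DIM_positive[where 'a='a] by linarith
qed

definition diff_span :: "(nat \<Rightarrow> int ^ 'd) \<Rightarrow> nat \<Rightarrow> (real ^ 'd) set" where
  "diff_span g m = span ((\<lambda>i. real_vec (g i - g 0)) ` {..<m})"

lemma orthogonal_diff_span:
  assumes "\<And>i. i \<le> n \<Longrightarrow> g i \<in> resonant F l s" "m \<le> n" "w \<in> diff_span g m"
  shows "real_vec l \<bullet> w = 0"
proof -
  have "orthogonal (real_vec l) w"
  proof (rule orthogonal_to_span[OF assms(3)[unfolded diff_span_def]])
    fix y assume "y \<in> (\<lambda>i. real_vec (g i - g 0)) ` {..<m}"
    then obtain i where "i < m" "y = real_vec (g i - g 0)" by auto
    then show "orthogonal (real_vec l) y"
      using resonant_orthogonal[OF assms(1)[of i] assms(1)[of 0]] assms(2)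
      by (simp add: orthogonal_def)
  qed
  then show ?thesis by (simp add: orthogonal_def)
qed

text \<open>
  Both shifts are orthogonal to the span of the differences, so a shift is determined by its
  class modulo this span.
\<close>
lemma shift_determined:
  assumes "\<And>i. i \<le> n \<Longrightarrow> g i \<in> resonant F l s" "\<And>i. i \<le> n \<Longrightarrow> g' i \<in> resonant F l' s'"
    and "m \<le> n" "diff_span g m = diff_span g' m"
    and "real_vec (l - l') \<in> diff_span g m"
  shows "l = l'"
proof -
  have "real_vec l = real_vec l'"
  proof (rule eq_of_orthogonal_of_diff_mem[of "diff_span g m"])
    fix w assume w: "w \<in> diff_span g m"
    show "real_vec l \<bullet> w = 0"
      by (rule orthogonal_diff_span[OF assms(1,3) w])
    show "real_vec l' \<bullet> w = 0"
      by (rule orthogonal_diff_span[OF assms(2,3)]) (use w assms(4) in auto)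
  qed (use assms(5) in \<open>simp add: real_vec_diff\<close>)
  then show ?thesis by simp
qed

text \<open>
  The terms in the expansion of the \<open>(n+1)\<close>-st powers of the sums over \<open>resonant F l s\<close> for which
  the linear dependence among the differences occurs at step \<open>m\<close>.
\<close>
definition dep_configs :: "nat \<Rightarrow> (int ^ 'd) set \<Rightarrow> ((int ^ 'd) \<times> int) set \<Rightarrow> nat
    \<Rightarrow> (((int ^ 'd) \<times> int) \<times> (nat \<Rightarrow> int ^ 'd)) set" where
  "dep_configs n F P m = {((l, s), g). (l, s) \<in> P \<and> g \<in> {..n} \<rightarrow>\<^sub>E resonant F l s \<and>
      real_vec (g m - g 0) \<in> diff_span g m}"

text \<open>
  The factors \<open>A (g i) * A (g i - l)\<close>, for \<open>i \<le> n\<close>, are distributed over two tuples.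
  \<open>shift_at\<close> takes the shifted frequency only at position \<open>m\<close>, \<open>shift_off\<close> at all the other
  positions. Each of the two tuples by itself determines \<open>l\<close>, \<open>s\<close> and \<open>g\<close>.
\<close>
definition shift_at :: "nat \<Rightarrow> (('c::minus \<times> int) \<times> (nat \<Rightarrow> 'c)) \<Rightarrow> nat \<Rightarrow> 'c" where
  "shift_at m = (\<lambda>((l, s), g). g(m := g m - l))"

definition shift_off :: "nat \<Rightarrow> nat \<Rightarrow> (('c::minus \<times> int) \<times> (nat \<Rightarrow> 'c)) \<Rightarrow> nat \<Rightarrow> 'c" where
  "shift_off n m = (\<lambda>((l, s), g). \<lambda>i\<in>{..n}. if i = m then g m else g i - l)"

lemma diff_span_closed:
  "x \<in> diff_span g m \<Longrightarrow> y \<in> diff_span g m \<Longrightarrow> x - y \<in> diff_span g m"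
  by (simp add: diff_span_def span_diff)

lemma diff_span_cong:
  "(\<And>i. i < m \<Longrightarrow> g i - g 0 = g' i - g' 0) \<Longrightarrow> diff_span g m = diff_span g' m"
  unfolding diff_span_def by (intro arg_cong[where f = span] image_cong) auto

text \<open>
  The unshifted entries before position \<open>m\<close> determine the span of the differences, and
  \<open>g 0 - (g m - l)\<close> equals \<open>l\<close> modulo that span.
\<close>
lemma inj_on_shift_at:
  assumes m: "1 \<le> m" "m \<le> n"
  shows "inj_on (shift_at m) (dep_configs n F P m)"
proof (rule inj_onI)
  fix t t'
  assume t: "t \<in> dep_configs n F P m" "t' \<in> dep_configs n F P m"
    and eq': "shift_at m t = shift_at m t'"
  obtain l s g l' s' g' where tt: "t = ((l, s), g)" "t' = ((l', s'), g')"
    by (metis prod.exhaust)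
  note eq = eq'[unfolded tt]
  from t tt have g: "g \<in> {..n} \<rightarrow>\<^sub>E resonant F l s" "real_vec (g m - g 0) \<in> diff_span g m"
    and g': "g' \<in> {..n} \<rightarrow>\<^sub>E resonant F l' s'" "real_vec (g' m - g' 0) \<in> diff_span g' m"
    by (auto simp: dep_configs_def)
  have mem: "\<And>i. i \<le> n \<Longrightarrow> g i \<in> resonant F l s" "\<And>i. i \<le> n \<Longrightarrow> g' i \<in> resonant F l' s'"
    using g(1) g'(1) by auto
  have fe: "(g(m := g m - l)) i = (g'(m := g' m - l')) i" for i
    using fun_cong[OF eq, of i] by (simp add: shift_at_def)
  have off: "g i = g' i" if "i \<noteq> m" for i
    using fe[of i] that by simp
  have at: "g m - l = g' m - l'"
    using fe[of m] by simp
  have 0: "g 0 = g' 0" using off[of 0] m by simp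
  have W: "diff_span g m = diff_span g' m"
    by (rule diff_span_cong) (use off 0 in auto)
  have "l - l' = (g m - g 0) - (g' m - g' 0)"
    using at 0 by (simp add: algebra_simps)
  then have "real_vec (l - l') = real_vec (g m - g 0) - real_vec (g' m - g' 0)"
    by (simp only: real_vec_diff)
  also have "\<dots> \<in> diff_span g m"
    by (rule diff_span_closed) (use g(2) g'(2) W in auto)
  finally have l: "l = l'"
    using shift_determined[OF mem m(2) W] by blast
  moreover have "s = s'"
    using mem(1)[of 0] mem(2)[of 0] 0 l by (simp add: resonant_def)
  moreover have "g = g'"
  proof
    fix i show "g i = g' i" using off[of i] at l by (cases "i = m") auto
  qed
  ultimately show "t = t'" by (simp add: tt)
qed

text \<open>
  Shifting all the entries before position \<open>m\<close> by the same \<open>l\<close> does not change their differences,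
  so the span is again determined, and \<open>g m - (g 0 - l)\<close> equals \<open>l\<close> modulo that span.
\<close>
lemma inj_on_shift_off:
  assumes m: "1 \<le> m" "m \<le> n"
  shows "inj_on (shift_off n m) (dep_configs n F P m)"
proof (rule inj_onI)
  fix t t'
  assume t: "t \<in> dep_configs n F P m" "t' \<in> dep_configs n F P m"
    and eq': "shift_off n m t = shift_off n m t'"
  obtain l s g l' s' g' where tt: "t = ((l, s), g)" "t' = ((l', s'), g')"
    by (metis prod.exhaust)
  note eq = eq'[unfolded tt]
  from t tt have g: "g \<in> {..n} \<rightarrow>\<^sub>E resonant F l s" "real_vec (g m - g 0) \<in> diff_span g m"
    and g': "g' \<in> {..n} \<rightarrow>\<^sub>E resonant F l' s'" "real_vec (g' m - g' 0) \<in> diff_span g' m"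
    by (auto simp: dep_configs_def)
  have mem: "\<And>i. i \<le> n \<Longrightarrow> g i \<in> resonant F l s" "\<And>i. i \<le> n \<Longrightarrow> g' i \<in> resonant F l' s'"
    using g(1) g'(1) by auto
  have fe: "(if i = m then g m else g i - l) = (if i = m then g' m else g' i - l')"
    if "i \<le> n" for i
    using fun_cong[OF eq, of i] that by (simp add: shift_off_def)
  have off: "g i - l = g' i - l'" if "i \<noteq> m" "i \<le> n" for i
    using fe[of i] that by simp
  have at: "g m = g' m"
    using fe[of m] m by simp
  have 0: "g 0 - l = g' 0 - l'" using off[of 0] m by simp
  have W: "diff_span g m = diff_span g' m"
  proof (rule diff_span_cong)
    fix i assume "i < m"
    then have "(g i - l) - (g 0 - l) = (g' i - l') - (g' 0 - l')"
      using off[of i] 0 m by simp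
    then show "g i - g 0 = g' i - g' 0" by simp
  qed
  have "l - l' = (g' m - g' 0) - (g m - g 0)"
    using at 0 by (simp add: algebra_simps)
  then have "real_vec (l - l') = real_vec (g' m - g' 0) - real_vec (g m - g 0)"
    by (simp only: real_vec_diff)
  also have "\<dots> \<in> diff_span g m"
    by (rule diff_span_closed) (use g(2) g'(2) W in auto)
  finally have l: "l = l'"
    using shift_determined[OF mem m(2) W] by blast
  have "g 0 = g' 0" using 0 l by simp
  then have "s = s'"
    using mem(1)[of 0] mem(2)[of 0] l by (simp add: resonant_def)
  moreover have "g = g'"
  proof
    fix i show "g i = g' i"
    proof (cases "i \<le> n")
      case True then show ?thesis using off[of i] at l by (cases "i = m") auto
    next
      case False then show ?thesis using g(1) g'(1) by (auto simp: PiE_def extensional_def)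
    qed
  qed
  ultimately show "t = t'" using l by (simp add: tt)
qed

lemma sum_prod_le_power:
  fixes A :: "'c \<Rightarrow> real"
  assumes "finite K" "inj_on \<phi> T" "\<phi> ` T \<subseteq> {..n::nat} \<rightarrow>\<^sub>E K" "(\<Sum>k\<in>K. (A k)\<^sup>2) \<le> M"
  shows "(\<Sum>t\<in>T. (\<Prod>i\<le>n. A (\<phi> t i))\<^sup>2) \<le> M ^ Suc n"
proof -
  have "(\<Sum>t\<in>T. (\<Prod>i\<le>n. A (\<phi> t i))\<^sup>2) = (\<Sum>h\<in>\<phi> ` T. (\<Prod>i\<le>n. A (h i))\<^sup>2)"
    by (simp add: sum.reindex[OF assms(2)])
  also have "\<dots> \<le> (\<Sum>h\<in>{..n} \<rightarrow>\<^sub>E K. (\<Prod>i\<le>n. A (h i))\<^sup>2)"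
    by (rule sum_mono2) (use assms in \<open>auto intro: finite_PiE\<close>)
  also have "\<dots> = (\<Sum>h\<in>{..n} \<rightarrow>\<^sub>E K. \<Prod>i\<le>n. (A (h i))\<^sup>2)"
    by (simp add: prod_power_distrib)
  also have "\<dots> = (\<Prod>i\<le>n. \<Sum>k\<in>K. (A k)\<^sup>2)"
    by (rule prod_sum_PiE[symmetric]) (use assms in auto)
  also have "\<dots> \<le> M ^ Suc n"
    using power_mono[OF assms(4), of "Suc n"] by (simp add: sum_nonneg)
  finally show ?thesis .
qed

text \<open>
  The inequality \<open>2 x y \<le> x\<^sup>2 + y\<^sup>2\<close> separates the two tuples into which each term splits. Each of
  the squares then appears at most once in the expansion of \<open>(\<Sum>k\<in>K. (A k)\<^sup>2) ^ Suc n\<close>.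
\<close>
lemma sum_dep_configs_le:
  fixes A :: "int ^ 'd \<Rightarrow> real"
  assumes "finite F" "finite P" "1 \<le> m" "m \<le> n"
    and M: "\<And>G. finite G \<Longrightarrow> (\<Sum>k\<in>G. (A k)\<^sup>2) \<le> M"
  shows "(\<Sum>((l, s), g)\<in>dep_configs n F P m. \<Prod>i\<le>n. A (g i) * A (g i - l)) \<le> M ^ Suc n"
proof -
  \<comment> \<open>All values of the two tuples, hence all frequencies in play, lie in \<open>K\<close>.\<close>
  define K where "K = F \<union> (\<Union>(l, s)\<in>P. (\<lambda>k. k - l) ` F)"
  have K: "finite K" using assms by (auto simp: K_def)
  let ?T = "dep_configs n F P m"
  have inK: "g i \<in> K" "g i - l \<in> K" if "((l, s), g) \<in> ?T" "i \<le> n" for l s g i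
  proof -
    from that have "(l, s) \<in> P" "g i \<in> F" by (auto simp: dep_configs_def resonant_def)
    then show "g i \<in> K" "g i - l \<in> K" by (auto simp: K_def)
  qed
  have outside: "g i = undefined" if "((l, s), g) \<in> ?T" "\<not> i \<le> n" for l s g i
    using that by (auto simp: dep_configs_def PiE_def extensional_def)
  have "shift_at m t \<in> {..n} \<rightarrow>\<^sub>E K \<and> shift_off n m t \<in> {..n} \<rightarrow>\<^sub>E K" if "t \<in> ?T" for t
  proof -
    obtain l s g where t: "t = ((l, s), g)" by (metis prod.exhaust)
    have "shift_at m t \<in> {..n} \<rightarrow>\<^sub>E K"
      by (rule PiE_I) (use inK outside that assms(4) in \<open>auto simp: shift_at_def t\<close>)
    moreover have "shift_off n m t \<in> {..n} \<rightarrow>\<^sub>E K"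
      by (rule PiE_I) (use inK that in \<open>auto simp: shift_off_def t\<close>)
    ultimately show ?thesis ..
  qed
  then have range: "shift_at m ` ?T \<subseteq> {..n} \<rightarrow>\<^sub>E K" "shift_off n m ` ?T \<subseteq> {..n} \<rightarrow>\<^sub>E K"
    by blast+
  have "(\<Sum>((l, s), g)\<in>?T. \<Prod>i\<le>n. A (g i) * A (g i - l))
     \<le> (\<Sum>t\<in>?T. ((\<Prod>i\<le>n. A (shift_at m t i))\<^sup>2 + (\<Prod>i\<le>n. A (shift_off n m t i))\<^sup>2) / 2)"
  proof (rule sum_mono, clarify)
    fix l s g
    have "(\<Prod>i\<le>n. A (g i) * A (g i - l))
        = (\<Prod>i\<le>n. A (shift_at m ((l, s), g) i) * A (shift_off n m ((l, s), g) i))"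
      by (rule prod.cong) (auto simp: shift_at_def shift_off_def)
    also have "\<dots> \<le> ((\<Prod>i\<le>n. A (shift_at m ((l, s), g) i))\<^sup>2
        + (\<Prod>i\<le>n. A (shift_off n m ((l, s), g) i))\<^sup>2) / 2"
      using sum_squares_bound[of "\<Prod>i\<le>n. A (shift_at m ((l, s), g) i)"
          "\<Prod>i\<le>n. A (shift_off n m ((l, s), g) i)"]
      by (simp add: prod.distrib)
    finally show "(\<Prod>i\<le>n. A (g i) * A (g i - l)) \<le> \<dots>" .
  qed
  also have "\<dots> \<le> M ^ Suc n"
    using sum_prod_le_power[OF K inj_on_shift_at[OF assms(3,4), of F P] range(1) M[OF K]]
      sum_prod_le_power[OF K inj_on_shift_off[OF assms(3,4), of F P] range(2) M[OF K]]
    by (simp add: sum.distrib flip: sum_divide_distrib)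
  finally show ?thesis .
qed

text \<open>
  Every term of the expanded power is counted for at least one of the \<open>d\<close> possible positions of
  the linear dependence.
\<close>
lemma sum_resonant_nonzero_le:
  fixes A :: "int ^ 'd::finite \<Rightarrow> real"
  assumes "finite F" "finite P" and nz: "\<And>l s. (l, s) \<in> P \<Longrightarrow> l \<noteq> 0"
    and A: "\<And>k. 0 \<le> A k"
    and M: "\<And>G. finite G \<Longrightarrow> (\<Sum>k\<in>G. (A k)\<^sup>2) \<le> M"
  shows "(\<Sum>(l, s)\<in>P. (\<Sum>k\<in>resonant F l s. A k * A (k - l)) ^ Suc CARD('d))
    \<le> real CARD('d) * M ^ Suc CARD('d)"
proof -
  define n where "n = CARD('d)"
  define w where "w = (\<lambda>((l, s::int), g). \<Prod>i\<le>n. A (g i) * A (g i - l))"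
  define T where "T = (SIGMA p:P. {..n} \<rightarrow>\<^sub>E resonant F (fst p) (snd p))"
  have fin_res: "finite (resonant F l s)" for l s
    using assms(1) by (simp add: resonant_def)
  have finT: "finite T"
    using assms(2) fin_res by (auto simp: T_def intro!: finite_PiE)
  have sub: "dep_configs n F P m \<subseteq> T" for m
    by (auto simp: T_def dep_configs_def)
  have cover: "T \<subseteq> (\<Union>m\<in>{1..n}. dep_configs n F P m)"
  proof clarify
    fix l s g assume t: "((l, s), g) \<in> T"
    then have mem: "g i \<in> resonant F l s" if "i \<le> n" for i
      using that by (auto simp: T_def)
    have "\<exists>m\<in>{1..DIM(real ^ 'd)}. real_vec (g m - g 0) \<in> span ((\<lambda>i. real_vec (g i - g 0)) ` {..<m})"
    proof (rule dependent_step_exists)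
      show "real_vec l \<noteq> 0" using t nz by (auto simp: T_def)
    next
      fix i assume "i \<le> DIM(real ^ 'd)"
      then show "real_vec l \<bullet> real_vec (g i - g 0) = 0"
        using resonant_orthogonal[OF mem[of i] mem[of 0]] by (simp add: n_def)
    qed simp
    then show "((l, s), g) \<in> (\<Union>m\<in>{1..n}. dep_configs n F P m)"
      using t by (auto simp: n_def dep_configs_def T_def diff_span_def)
  qed
  have w: "0 \<le> w t" for t
    using A by (auto simp: w_def intro!: prod_nonneg split: prod.split)
  have "(\<Sum>(l, s)\<in>P. (\<Sum>k\<in>resonant F l s. A k * A (k - l)) ^ Suc n)
      = (\<Sum>p\<in>P. \<Sum>g\<in>{..n} \<rightarrow>\<^sub>E resonant F (fst p) (snd p). w (p, g))"
  proof (rule sum.cong, simp, clarify)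
    fix l s
    have "(\<Sum>k\<in>resonant F l s. A k * A (k - l)) ^ Suc n
        = (\<Prod>i\<le>n. \<Sum>k\<in>resonant F l s. A k * A (k - l))" by simp
    also have "\<dots> = (\<Sum>g\<in>{..n} \<rightarrow>\<^sub>E resonant F l s. w ((l, s), g))"
      by (subst prod_sum_PiE) (use fin_res in \<open>auto simp: w_def\<close>)
    finally show "(\<Sum>k\<in>resonant F l s. A k * A (k - l)) ^ Suc n
      = (\<Sum>g\<in>{..n} \<rightarrow>\<^sub>E resonant F (fst (l, s)) (snd (l, s)). w ((l, s), g))" by simp
  qed
  also have "\<dots> = sum w T"
    unfolding T_def by (subst sum.Sigma) (use assms(2) fin_res in \<open>auto intro!: finite_PiE simp: split_def\<close>)
  also have "\<dots> \<le> (\<Sum>t\<in>T. \<Sum>m=1..n. if t \<in> dep_configs n F P m then w t else 0)"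
  proof (rule sum_mono)
    fix t assume "t \<in> T"
    then obtain m where m: "m \<in> {1..n}" "t \<in> dep_configs n F P m" using cover by blast
    then show "w t \<le> (\<Sum>m=1..n. if t \<in> dep_configs n F P m then w t else 0)"
      using member_le_sum[of m "{1..n}" "\<lambda>m. if t \<in> dep_configs n F P m then w t else 0"] w
      by auto
  qed
  also have "\<dots> = (\<Sum>m=1..n. sum w (dep_configs n F P m))"
  proof (subst sum.swap, rule sum.cong, simp)
    fix m
    have "T \<inter> {t. t \<in> dep_configs n F P m} = dep_configs n F P m" using sub by auto
    then show "(\<Sum>t\<in>T. if t \<in> dep_configs n F P m then w t else 0) = sum w (dep_configs n F P m)"
      by (simp add: sum.inter_restrict[OF finT, symmetric] flip: sum.If_cases)
  qed
  also have "\<dots> \<le> (\<Sum>m=1..n. M ^ Suc n)"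
  proof (rule sum_mono)
    fix m assume "m \<in> {1..n}"
    then show "sum w (dep_configs n F P m) \<le> M ^ Suc n"
      using sum_dep_configs_le[OF assms(1,2), of m n A M] M by (simp add: w_def split_def)
  qed
  finally show ?thesis by (simp add: n_def)
qed

text \<open>
  For \<open>l = 0\<close> there is no hyperplane, but \<open>resonant F 0 s\<close> is all of \<open>F\<close> for \<open>s = 0\<close> and empty
  otherwise; this accounts for the extra \<open>1\<close> in the constant.
\<close>
lemma sum_resonant_le:
  fixes A :: "int ^ 'd::finite \<Rightarrow> real"
  assumes "finite F" "finite P"
    and A: "\<And>k. 0 \<le> A k"
    and M: "\<And>G. finite G \<Longrightarrow> (\<Sum>k\<in>G. (A k)\<^sup>2) \<le> M"
  shows "(\<Sum>(l, s)\<in>P. (\<Sum>k\<in>resonant F l s. A k * A (k - l)) ^ Suc CARD('d))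
    \<le> (real CARD('d) + 1) * M ^ Suc CARD('d)"
proof -
  let ?f = "\<lambda>(l, s). (\<Sum>k\<in>resonant F l s. A k * A (k - l)) ^ Suc CARD('d)"
  have M0: "0 \<le> M" using M[of "{}"] by simp
  have nonneg: "0 \<le> ?f p" for p
    using A by (cases p) (auto intro!: zero_le_power sum_nonneg mult_nonneg_nonneg simp del: power_Suc)
  have zero: "?f (0, s) = (if s = 0 then (\<Sum>k\<in>F. (A k)\<^sup>2) ^ Suc CARD('d) else 0)" for s
    by (simp add: resonant_def power2_eq_square)
  define P0 P1 where "P0 = {p \<in> P. fst p = 0}" and "P1 = {p \<in> P. fst p \<noteq> 0}"
  have "sum ?f P0 \<le> sum ?f (Pair 0 ` ({0} \<union> snd ` P))"
  proof (rule sum_mono2)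
    show "P0 \<subseteq> Pair 0 ` ({0} \<union> snd ` P)" by (force simp: P0_def)
  qed (use assms nonneg in auto)
  also have "\<dots> = (\<Sum>s\<in>{0} \<union> snd ` P. ?f (0, s))"
    by (subst sum.reindex) (auto simp: inj_on_def)
  also have "\<dots> = (\<Sum>k\<in>F. (A k)\<^sup>2) ^ Suc CARD('d)"
    unfolding zero using assms(2) by (subst sum.delta) auto
  also have "\<dots> \<le> M ^ Suc CARD('d)"
    by (rule power_mono) (use M assms(1) in \<open>auto intro: sum_nonneg\<close>)
  finally have 0: "sum ?f P0 \<le> M ^ Suc CARD('d)" .
  have 1: "sum ?f P1 \<le> real CARD('d) * M ^ Suc CARD('d)"
    by (rule sum_resonant_nonzero_le) (use assms in \<open>auto simp: P1_def\<close>)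
  have "sum ?f P = sum ?f P0 + sum ?f P1"
    unfolding P0_def P1_def using assms(2)
    by (subst sum.union_disjoint[symmetric]) (auto intro!: sum.cong)
  with 0 1 show ?thesis by (simp add: algebra_simps)
qed

section \<open>Orthogonality of characters on the torus\<close>

abbreviation cube :: "'a::euclidean_space set" where
  "cube \<equiv> cbox 0 ((2 * pi) *\<^sub>R One)"

lemma measure_cube: "measure lborel (cube :: 'a::euclidean_space set) = (2 * pi) ^ DIM('a)"
proof -
  have "measure lborel (cube :: 'a set) = (\<Prod>b\<in>(Basis :: 'a set). ((2 * pi) *\<^sub>R One - 0) \<bullet> b)"
    by (rule measure_lborel_cbox) simp
  also have "\<dots> = (2 * pi) ^ DIM('a)" by simp
  finally show ?thesis .
qed

lemma emeasure_cube: "emeasure lebesgue (cube :: 'a::euclidean_space set) = ennreal ((2 * pi) ^ DIM('a))"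
proof -
  have "emeasure lborel (cube :: 'a set) = ennreal (measure lborel (cube :: 'a set))"
    by (rule emeasure_eq_ennreal_measure) (simp add: emeasure_lborel_cbox_eq)
  then show ?thesis by (simp add: measure_cube)
qed

lemma torus_density:
  "(torus :: 'a::euclidean_space measure)
    = density lebesgue (\<lambda>x. ennreal (indicator cube x / (2 * pi) ^ DIM('a)))"
  unfolding torus_def uniform_measure_def emeasure_cube
  by (intro arg_cong[where f = "density lebesgue"] ext)
     (auto simp: indicator_def divide_ennreal[symmetric])

lemma space_torus [simp]: "space torus = UNIV"
  by (simp add: torus_def)

lemma sets_torus [measurable_cong]: "sets torus = sets lebesgue"
  by (simp add: torus_def)

lemma borel_imp_measurable_torus: "f \<in> borel_measurable borel \<Longrightarrow> f \<in> borel_measurable torus"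
  unfolding measurable_cong_sets[OF sets_torus refl] by (rule measurable_completion) simp

lemma emeasure_torus_UNIV: "emeasure (torus :: 'a::euclidean_space measure) UNIV = 1"
proof -
  have "emeasure (torus :: 'a measure) UNIV
      = emeasure lebesgue (cube :: 'a set) / emeasure lebesgue (cube :: 'a set)"
    unfolding torus_def by (subst emeasure_uniform_measure) auto
  also have "\<dots> = 1"
    by (subst (1 2) emeasure_cube) (simp add: divide_ennreal)
  finally show ?thesis .
qed

interpretation torus: finite_measure torus
proof (rule finite_measureI)
  show "emeasure torus (space torus) \<noteq> \<infinity>" unfolding space_torus emeasure_torus_UNIV by simp
qed

lemma measure_torus_UNIV [simp]: "measure torus UNIV = 1"
  unfolding measure_def emeasure_torus_UNIV by simp

text \<open>
  Fubini's theorem: the indicator of the cube and Lebesgue measure both factor over the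
  coordinates.
\<close>
lemma integral_torus_prod:
  fixes f :: "'a::euclidean_space \<Rightarrow> real \<Rightarrow> complex"
  assumes cont: "\<And>b. b \<in> Basis \<Longrightarrow> continuous_on UNIV (f b)"
  shows "(LINT x|torus. (\<Prod>b\<in>Basis. f b (x \<bullet> b)))
    = (\<Prod>b\<in>Basis. (LINT t|lborel. indicator {0..2 * pi} t *\<^sub>R f b t) / (2 * pi))"
proof -
  interpret product_sigma_finite "\<lambda>_::'a. lborel :: real measure" ..
  define g where "g b t = (indicator {0..2 * pi} t / (2 * pi)) *\<^sub>R f b t" for b t
  have [measurable]: "f b \<in> borel_measurable borel" if "b \<in> Basis" for b
    using cont[OF that] by (rule borel_measurable_continuous_onI)
  have [measurable]: "g b \<in> borel_measurable borel" if "b \<in> Basis" for b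
    using that unfolding g_def by measurable
  have g_int: "integrable lborel (g b)" if "b \<in> Basis" for b
  proof -
    have "set_integrable lborel {0..2 * pi} (f b)"
      by (rule borel_integrable_compact[unfolded set_integrable_def[symmetric]])
         (use cont[OF that] continuous_on_subset in auto)
    then have "integrable lborel (\<lambda>t. (1 / (2 * pi)) *\<^sub>R (indicator {0..2 * pi} t *\<^sub>R f b t))"
      unfolding set_integrable_def by (rule integrable_scaleR_right)
    then show ?thesis by (simp add: g_def[abs_def])
  qed
  have ind: "indicator cube x / (2 * pi) ^ DIM('a) = (\<Prod>b\<in>Basis. indicator {0..2 * pi} (x \<bullet> b) / (2 * pi :: real))"
    for x :: 'a
  proof (cases "x \<in> cube")
    case True
    then show ?thesis by (simp add: mem_box power_divide power_mult_distrib)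
  next
    case False
    then obtain b where b: "b \<in> Basis" "x \<bullet> b \<notin> {0..2 * pi}" by (auto simp: mem_box)
    then have "(\<Prod>b\<in>Basis. indicator {0..2 * pi} (x \<bullet> b) / (2 * pi :: real)) = 0"
      using b(2) by (intro prod_zero[OF finite_Basis bexI[OF _ b(1)]]) simp
    with False show ?thesis by simp
  qed
  have [measurable]: "(\<lambda>x::'a. \<Prod>b\<in>Basis. f b (x \<bullet> b)) \<in> borel_measurable borel"
    by measurable
  have "(LINT x|torus. (\<Prod>b\<in>Basis. f b (x \<bullet> b)))
      = (LINT x|lebesgue. (indicator cube x / (2 * pi) ^ DIM('a)) *\<^sub>R (\<Prod>b\<in>Basis. f b (x \<bullet> b)))"
    unfolding torus_density
    by (subst integral_density) (auto intro!: measurable_completion)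
  also have "\<dots> = (LINT x|lborel. (indicator cube x / (2 * pi) ^ DIM('a)) *\<^sub>R (\<Prod>b\<in>Basis. f b (x \<bullet> b)))"
    by (rule integral_completion) measurable
  also have "\<dots> = (LINT x|(lborel :: 'a measure). (\<Prod>b\<in>Basis. g b (x \<bullet> b)))"
    unfolding ind g_def by (simp add: scaleR_conv_of_real flip: prod.distrib)
  also have "\<dots> = (LINT y|(\<Pi>\<^sub>M b\<in>(Basis :: 'a set). lborel). (\<Prod>b\<in>Basis. g b ((\<Sum>b'\<in>Basis. y b' *\<^sub>R b') \<bullet> b)))"
  proof -
    have [measurable]: "(\<lambda>x::'a. \<Prod>b\<in>Basis. g b (x \<bullet> b)) \<in> borel_measurable borel"
      by measurable
    have [measurable]: "(\<lambda>y. \<Sum>b\<in>Basis. y b *\<^sub>R b) \<in> (\<Pi>\<^sub>M b\<in>(Basis :: 'a set). lborel) \<rightarrow>\<^sub>M borel"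
      by measurable
    have "integral\<^sup>L (distr (\<Pi>\<^sub>M b\<in>(Basis :: 'a set). lborel) borel (\<lambda>y. \<Sum>b\<in>Basis. y b *\<^sub>R b))
          (\<lambda>x. \<Prod>b\<in>Basis. g b (x \<bullet> b))
        = (LINT y|(\<Pi>\<^sub>M b\<in>(Basis :: 'a set). lborel). (\<Prod>b\<in>Basis. g b ((\<Sum>b'\<in>Basis. y b' *\<^sub>R b') \<bullet> b)))"
      by (rule integral_distr; measurable)
    then show ?thesis
      by (simp only: lborel_eq[symmetric])
  qed
  also have "\<dots> = (LINT y|(\<Pi>\<^sub>M b\<in>(Basis :: 'a set). lborel). (\<Prod>b\<in>Basis. g b (y b)))"
    by (intro Bochner_Integration.integral_cong prod.cong refl) simp
  also have "\<dots> = (\<Prod>b\<in>Basis. LINT t|lborel. g b t)"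
    by (rule product_integral_prod) (use g_int in auto)
  also have "\<dots> = (\<Prod>b\<in>Basis. (LINT t|lborel. indicator {0..2 * pi} t *\<^sub>R f b t) / (2 * pi))"
  proof (rule prod.cong[OF refl])
    fix b
    define I where "I = (LINT t|lborel. indicator {0..2 * pi} t *\<^sub>R f b t)"
    have "(LINT t|lborel. g b t) = (LINT t|lborel. (1 / (2 * pi)) *\<^sub>R (indicator {0..2 * pi} t *\<^sub>R f b t))"
      by (simp add: g_def)
    also have "\<dots> = (1 / (2 * pi)) *\<^sub>R I"
      unfolding I_def by (rule integral_scaleR_right)
    also have "\<dots> = I / (2 * pi)"
      by (simp add: scaleR_conv_of_real)
    finally show "(LINT t|lborel. g b t) = (LINT t|lborel. indicator {0..2 * pi} t *\<^sub>R f b t) / (2 * pi)"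
      by (simp only: I_def)
  qed
  finally show ?thesis .
qed

lemma integral_period_cis:
  fixes m :: int
  shows "(LINT t|lborel. indicator {0..2 * pi} t *\<^sub>R cis (of_int m * t)) = (if m = 0 then 2 * pi else 0)"
proof (cases "m = 0")
  case True
  then show ?thesis by (simp add: scaleR_conv_of_real)
next
  case False
  have "(LINT t|lborel. indicator {0..2 * pi} t *\<^sub>R cis (of_int m * t))
      = cis (of_int m * (2 * pi)) / (\<i> * of_int m) - cis (of_int m * 0) / (\<i> * of_int m)"
  proof (rule integral_FTC_Icc)
    fix t
    have "((\<lambda>t. exp (\<i> * of_int m * of_real t) / (\<i> * of_int m)) has_vector_derivative
        exp (\<i> * of_int m * of_real t)) (at t within {0..2 * pi})"
      by (rule has_vector_derivative_real_field) (use False in \<open>auto intro!: derivative_eq_intros\<close>)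
    then show "((\<lambda>t. cis (of_int m * t) / (\<i> * of_int m)) has_vector_derivative cis (of_int m * t))
        (at t within {0..2 * pi})"
      by (simp add: cis_conv_exp mult_ac)
  qed (auto intro!: continuous_intros)
  also have "cis (of_int m * (2 * pi)) = 1"
    using cis_multiple_2pi[of "of_int m"] by (simp add: mult_ac)
  finally show ?thesis using False by simp
qed

lemma integral_torus_cis:
  fixes m :: "'a::euclidean_space \<Rightarrow> int"
  shows "(LINT x|torus. cis (\<Sum>b\<in>Basis. of_int (m b) * (x \<bullet> b))) = of_bool (\<forall>b\<in>Basis. m b = 0)"
proof -
  have cis_sum: "cis (sum h A) = (\<Prod>b\<in>A. cis (h b))" if "finite A" for h :: "'a \<Rightarrow> real" and A
    using that by (induction A rule: finite_induct) (auto simp: cis_mult[symmetric])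
  have "(LINT x|torus. cis (\<Sum>b\<in>Basis. of_int (m b) * (x \<bullet> b)))
      = (LINT x|torus. (\<Prod>b\<in>Basis. cis (of_int (m b) * (x \<bullet> b))))"
    by (simp add: cis_sum)
  also have "\<dots> = (\<Prod>b\<in>(Basis :: 'a set). of_bool (m b = 0))"
    by (subst integral_torus_prod) (auto simp: integral_period_cis intro!: continuous_intros prod.cong)
  also have "\<dots> = of_bool (\<forall>b\<in>Basis. m b = 0)"
    by (cases "\<forall>b\<in>Basis. m b = 0") auto
  finally show ?thesis .
qed

lemma integral_torus_cis_real: "(LINT t|torus. cis (of_int m * t)) = of_bool (m = 0)"
  using integral_torus_cis[where 'a = real, of "\<lambda>_. m"] by simp

text \<open>
  In the coordinates given by \<open>Basis\<close> the frequency \<open>k\<close> has the components \<open>r \<bullet> b\<close>, which are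
  integers; the floor only turns them into elements of type \<open>int\<close>.
\<close>
lemma integral_torus_cis_freq: "(LINT x|torus. cis (freq_inner k x)) = of_bool (k = 0)"
proof -
  define r where "r = (\<chi> i. real_of_int (k $ i))"
  have r_axis: "r \<bullet> axis i 1 = of_int (k $ i)" for i
    by (simp add: inner_axis r_def)
  have freq: "freq_inner k x = (\<Sum>b\<in>Basis. of_int \<lfloor>r \<bullet> b\<rfloor> * (x \<bullet> b))" for x
  proof -
    have "freq_inner k x = r \<bullet> x"
      by (simp add: freq_inner_def inner_vec_def r_def)
    also have "\<dots> = (\<Sum>b\<in>Basis. (r \<bullet> b) * (x \<bullet> b))"
      by (rule euclidean_inner)
    also have "\<dots> = (\<Sum>b\<in>Basis. of_int \<lfloor>r \<bullet> b\<rfloor> * (x \<bullet> b))"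
      by (intro sum.cong) (auto simp: Basis_vec_def r_axis)
    finally show ?thesis .
  qed
  have "(LINT x|torus. cis (freq_inner k x)) = of_bool (\<forall>b\<in>Basis. \<lfloor>r \<bullet> b\<rfloor> = 0)"
    unfolding freq by (rule integral_torus_cis)
  also have "(\<forall>b\<in>Basis. \<lfloor>r \<bullet> b\<rfloor> = 0) \<longleftrightarrow> k = 0"
    by (auto simp: Basis_vec_def r_axis vec_eq_iff)
  finally show ?thesis .
qed

section \<open>Square-integrable functions\<close>

definition square_integrable :: "'a measure \<Rightarrow> ('a \<Rightarrow> complex) \<Rightarrow> bool" where
  "square_integrable M f \<longleftrightarrow> f \<in> borel_measurable M \<and> integrable M (\<lambda>x. (cmod (f x))\<^sup>2)"

lemma L2_torus_iff: "f \<in> L2_torus \<longleftrightarrow> torus_periodic f \<and> square_integrable torus f"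
  by (auto simp: L2_torus_def square_integrable_def)

lemma square_integrable_measurable: "square_integrable M f \<Longrightarrow> f \<in> borel_measurable M"
  by (simp add: square_integrable_def)

lemma square_integrable_mult_bounded:
  assumes f: "square_integrable M f" and c: "c \<in> borel_measurable M" "\<And>x. cmod (c x) \<le> 1"
  shows "square_integrable M (\<lambda>x. f x * c x)"
  unfolding square_integrable_def
proof
  have [measurable]: "f \<in> borel_measurable M" "c \<in> borel_measurable M"
    using f c by (auto simp: square_integrable_def)
  show "(\<lambda>x. f x * c x) \<in> borel_measurable M" by measurable
  show "integrable M (\<lambda>x. (cmod (f x * c x))\<^sup>2)"
  proof (rule Bochner_Integration.integrable_bound)
    show "integrable M (\<lambda>x. (cmod (f x))\<^sup>2)" using f by (simp add: square_integrable_def)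
    show "AE x in M. norm ((cmod (f x * c x))\<^sup>2) \<le> norm ((cmod (f x))\<^sup>2)"
      using c(2) by (auto simp: norm_mult power_mult_distrib intro!: mult_left_le power_le_one)
  qed measurable
qed

lemma square_integrable_prod:
  assumes "square_integrable M f" "square_integrable M g"
  shows "integrable M (\<lambda>x. f x * cnj (g x))" "integrable M (\<lambda>x. cmod (f x) * cmod (g x))"
proof -
  have [measurable]: "f \<in> borel_measurable M" "g \<in> borel_measurable M"
    using assms by (auto simp: square_integrable_def)
  have int: "integrable M (\<lambda>x. (cmod (f x))\<^sup>2 + (cmod (g x))\<^sup>2)"
    using assms by (auto simp: square_integrable_def)
  have bound: "cmod (f x) * cmod (g x) \<le> (cmod (f x))\<^sup>2 + (cmod (g x))\<^sup>2" for x
  proof -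
    have "2 * (cmod (f x) * cmod (g x)) \<le> (cmod (f x))\<^sup>2 + (cmod (g x))\<^sup>2"
      using sum_squares_bound[of "cmod (f x)" "cmod (g x)"] by (simp only: mult.assoc)
    moreover have "0 \<le> cmod (f x) * cmod (g x)" by simp
    ultimately show ?thesis by linarith
  qed
  show "integrable M (\<lambda>x. cmod (f x) * cmod (g x))"
    by (rule Bochner_Integration.integrable_bound[OF int]) (use bound in auto)
  have [measurable]: "(\<lambda>x. cnj (g x)) \<in> borel_measurable M"
    by (rule measurable_compose[OF \<open>g \<in> borel_measurable M\<close> borel_measurable_continuous_onI])
       (intro continuous_intros)
  show "integrable M (\<lambda>x. f x * cnj (g x))"
    by (rule Bochner_Integration.integrable_bound[OF int]) (use bound in \<open>auto simp: norm_mult\<close>)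
qed

lemma cmod_diff_square_le: "(cmod (z - w))\<^sup>2 \<le> 2 * (cmod z)\<^sup>2 + 2 * (cmod w)\<^sup>2"
proof -
  have "(cmod (z - w))\<^sup>2 \<le> (cmod z + cmod w)\<^sup>2"
    by (rule power_mono[OF norm_triangle_ineq4]) simp
  also have "\<dots> \<le> 2 * (cmod z)\<^sup>2 + 2 * (cmod w)\<^sup>2"
    using sum_squares_bound[of "cmod z" "cmod w"] by (simp add: power2_sum)
  finally show ?thesis .
qed

lemma square_integrable_diff:
  assumes "square_integrable M f" "square_integrable M g"
  shows "square_integrable M (\<lambda>x. f x - g x)"
  unfolding square_integrable_def
proof
  have [measurable]: "f \<in> borel_measurable M" "g \<in> borel_measurable M"
    using assms by (auto simp: square_integrable_def)
  show "(\<lambda>x. f x - g x) \<in> borel_measurable M" by measurable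
  have int: "integrable M (\<lambda>x. 2 * (cmod (f x))\<^sup>2 + 2 * (cmod (g x))\<^sup>2)"
    using assms by (auto simp: square_integrable_def)
  show "integrable M (\<lambda>x. (cmod (f x - g x))\<^sup>2)"
    by (rule Bochner_Integration.integrable_bound[OF int]) (use cmod_diff_square_le in auto)
qed

lemma square_integrable_add:
  assumes "square_integrable M f" "square_integrable M g"
  shows "square_integrable M (\<lambda>x. f x + g x)"
proof -
  have "square_integrable M (\<lambda>x. f x - (0 - g x))"
    by (intro square_integrable_diff assms) (simp add: square_integrable_def)
  then show ?thesis by simp
qed

lemma square_integrable_sum:
  assumes "\<And>i. i \<in> I \<Longrightarrow> square_integrable M (f i)"
  shows "square_integrable M (\<lambda>x. \<Sum>i\<in>I. f i x)"
  using assms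
proof (induction I rule: infinite_finite_induct)
  case (insert i I)
  then have "square_integrable M (\<lambda>x. f i x + (\<Sum>i\<in>I. f i x))"
    by (intro square_integrable_add) auto
  with insert show ?case by simp
qed (simp_all add: square_integrable_def)

text \<open>
  The integral of \<open>(t |f| - |g|)\<^sup>2\<close> is a nonnegative quadratic polynomial in \<open>t\<close>.
\<close>
lemma Cauchy_Schwarz_integral:
  assumes "square_integrable M f" "square_integrable M g"
  shows "cmod (LINT x|M. f x * cnj (g x))
    \<le> sqrt (LINT x|M. (cmod (f x))\<^sup>2) * sqrt (LINT x|M. (cmod (g x))\<^sup>2)"
proof -
  define a b c where "a = (LINT x|M. (cmod (f x))\<^sup>2)" and "b = (LINT x|M. (cmod (g x))\<^sup>2)"
    and "c = (LINT x|M. cmod (f x) * cmod (g x))"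
  have int: "integrable M (\<lambda>x. (cmod (f x))\<^sup>2)" "integrable M (\<lambda>x. (cmod (g x))\<^sup>2)"
    using assms by (auto simp: square_integrable_def)
  note int_prod = square_integrable_prod[OF assms]
  have nonneg: "0 \<le> a" "0 \<le> b" "0 \<le> c" by (simp_all add: a_def b_def c_def)
  have quad: "0 \<le> t\<^sup>2 * a - 2 * t * c + b" for t
  proof -
    have "0 \<le> (LINT x|M. (t * cmod (f x) - cmod (g x))\<^sup>2)" by simp
    also have "\<dots> = (LINT x|M. t\<^sup>2 * (cmod (f x))\<^sup>2 - (2 * t) * (cmod (f x) * cmod (g x)) + (cmod (g x))\<^sup>2)"
      by (intro Bochner_Integration.integral_cong) (auto simp: power2_eq_square algebra_simps)
    also have "\<dots> = t\<^sup>2 * a - 2 * t * c + b"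
      using int int_prod(2) by (simp add: a_def b_def c_def)
    finally show ?thesis .
  qed
  have "c\<^sup>2 \<le> a * b"
  proof (cases "a = 0")
    case True
    have "c = 0"
    proof (rule ccontr)
      assume "c \<noteq> 0"
      \<comment> \<open>This \<open>t\<close> makes the affine function \<open>b - 2 t c\<close> equal to \<open>-1\<close>.\<close>
      then show False using quad[of "(b + 1) / (2 * c)"] nonneg True by (simp add: field_simps)
    qed
    then show ?thesis using True by simp
  next
    case False
    \<comment> \<open>The minimum of the quadratic is attained at \<open>c / a\<close>.\<close>
    with quad[of "c / a"] nonneg show ?thesis
      by (simp add: power2_eq_square divide_simps algebra_simps split: if_splits)
  qed
  then have "c \<le> sqrt a * sqrt b"
    using nonneg by (metis real_le_rsqrt real_sqrt_mult)
  moreover have "cmod (LINT x|M. f x * cnj (g x)) \<le> c"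
    unfolding c_def using integral_norm_bound[of M "\<lambda>x. f x * cnj (g x)"] by (simp add: norm_mult)
  ultimately show ?thesis by (simp add: a_def b_def)
qed

lemma L2_norm_nonneg [simp]: "0 \<le> L2_norm f"
  by (simp add: L2_norm_def)

lemma L2_norm_sq: "(L2_norm f)\<^sup>2 = (LINT x|torus. (cmod (f x))\<^sup>2)"
  by (simp add: L2_norm_def)

definition L2_inner :: "('a::euclidean_space \<Rightarrow> complex) \<Rightarrow> ('a \<Rightarrow> complex) \<Rightarrow> complex" where
  "L2_inner f g = (LINT x|torus. f x * cnj (g x))"

lemma L2_inner_le:
  "square_integrable torus f \<Longrightarrow> square_integrable torus g \<Longrightarrow> cmod (L2_inner f g) \<le> L2_norm f * L2_norm g"
  unfolding L2_inner_def L2_norm_def by (rule Cauchy_Schwarz_integral)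

lemma L2_inner_self: "L2_inner f f = of_real ((L2_norm f)\<^sup>2)"
  unfolding L2_inner_def L2_norm_sq by (simp add: complex_norm_square[symmetric] del: of_real_power)

lemma L2_inner_commute: "L2_inner g f = cnj (L2_inner f g)"
proof -
  have "L2_inner g f = (LINT x|torus. cnj (f x * cnj (g x)))"
    by (simp add: L2_inner_def mult.commute del: Bochner_Integration.integral_cnj)
  then show ?thesis by (simp only: Bochner_Integration.integral_cnj L2_inner_def)
qed

lemma L2_inner_diff_left:
  "square_integrable torus f \<Longrightarrow> square_integrable torus g \<Longrightarrow> square_integrable torus h \<Longrightarrow>
    L2_inner (\<lambda>x. f x - g x) h = L2_inner f h - L2_inner g h"
  unfolding L2_inner_def by (simp add: left_diff_distrib square_integrable_prod)

lemma L2_inner_diff_right: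
  "square_integrable torus f \<Longrightarrow> square_integrable torus g \<Longrightarrow> square_integrable torus h \<Longrightarrow>
    L2_inner h (\<lambda>x. f x - g x) = L2_inner h f - L2_inner h g"
  unfolding L2_inner_def by (simp add: right_diff_distrib square_integrable_prod)

section \<open>Trigonometric polynomials and Bessel's inequality\<close>

definition torus_char :: "int ^ 'd \<Rightarrow> real ^ 'd \<Rightarrow> complex" where
  "torus_char k x = cis (freq_inner k x)"

definition trig_poly :: "(int ^ 'd \<Rightarrow> complex) \<Rightarrow> (int ^ 'd) set \<Rightarrow> real ^ 'd \<Rightarrow> complex" where
  "trig_poly a F x = (\<Sum>k\<in>F. a k * torus_char k x)"

lemma freq_inner_diff: "freq_inner (k - j) x = freq_inner k x - freq_inner j x"
  by (simp add: freq_inner_def left_diff_distrib sum_subtractf)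

lemma torus_char_diff: "torus_char k x * cnj (torus_char j x) = torus_char (k - j) x"
  by (simp add: torus_char_def cis_cnj freq_inner_diff cis_mult)

lemma norm_torus_char [simp]: "cmod (torus_char k x) = 1"
  by (simp add: torus_char_def)

lemma torus_char_measurable: "torus_char k \<in> borel_measurable torus"
proof -
  have "continuous_on UNIV (torus_char k)"
    unfolding torus_char_def[abs_def] freq_inner_def by (intro continuous_intros)
  then show ?thesis
    by (rule borel_imp_measurable_torus[OF borel_measurable_continuous_onI])
qed

lemma torus_char_periodic: "torus_periodic (torus_char k)"
proof -
  have "torus_char k (x + (2 * pi) *\<^sub>R axis i 1) = torus_char k x" for x i
  proof -
    have "freq_inner k (x + (2 * pi) *\<^sub>R axis i 1)
        = freq_inner k x + (\<Sum>j\<in>UNIV. if j = i then of_int (k $ i) * (2 * pi) else 0)"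
      unfolding freq_inner_def sum.distrib[symmetric]
      by (rule sum.cong) (auto simp: axis_def algebra_simps)
    also have "\<dots> = freq_inner k x + 2 * pi * of_int (k $ i)" by simp
    finally show ?thesis
      by (simp add: torus_char_def cis_mult[symmetric] cis_multiple_2pi)
  qed
  then show ?thesis by (auto simp: torus_periodic_def Basis_vec_def)
qed

lemma torus_char_square_integrable: "square_integrable torus (torus_char k)"
  by (simp add: square_integrable_def torus_char_measurable)

lemma torus_char_orthonormal: "L2_inner (torus_char k) (torus_char j) = of_bool (k = j)"
  unfolding L2_inner_def torus_char_diff by (simp add: torus_char_def integral_torus_cis_freq)

lemma fourier_coeff_eq_inner: "fourier_coeff f k = L2_inner f (torus_char k)"
  by (simp add: fourier_coeff_def L2_inner_def torus_char_def cis_cnj)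

lemma trig_poly_square_integrable: "square_integrable torus (trig_poly a F)"
  unfolding trig_poly_def[abs_def]
proof (rule square_integrable_sum)
  fix k
  show "square_integrable torus (\<lambda>x. a k * torus_char k x)"
    unfolding square_integrable_def
    using torus_char_measurable[of k] by (auto simp: norm_mult)
qed

lemma trig_poly_periodic: "torus_periodic (trig_poly a F)"
  by (simp add: torus_periodic_def trig_poly_def
      torus_char_periodic[unfolded torus_periodic_def, rule_format])

lemma trig_poly_inner:
  assumes f: "square_integrable torus f"
  shows "L2_inner (trig_poly a F) f = (\<Sum>k\<in>F. a k * cnj (fourier_coeff f k))"
proof -
  have "L2_inner (trig_poly a F) f = (LINT x|torus. (\<Sum>k\<in>F. a k * (torus_char k x * cnj (f x))))"
    by (simp add: L2_inner_def trig_poly_def sum_distrib_right mult.assoc)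
  also have "\<dots> = (\<Sum>k\<in>F. a k * L2_inner (torus_char k) f)"
    using square_integrable_prod(1)[OF torus_char_square_integrable f]
    by (simp add: L2_inner_def)
  finally show ?thesis
    by (simp add: fourier_coeff_eq_inner flip: L2_inner_commute)
qed

lemma fourier_coeff_trig_poly:
  assumes "finite F"
  shows "fourier_coeff (trig_poly a F) k = (if k \<in> F then a k else 0)"
proof -
  have "fourier_coeff (trig_poly a F) k = (\<Sum>j\<in>F. a j * of_bool (k = j))"
    unfolding fourier_coeff_eq_inner
      trig_poly_inner[OF torus_char_square_integrable] torus_char_orthonormal
    by (intro sum.cong) auto
  then show ?thesis using assms by (simp add: of_bool_def if_distrib cong: if_cong)
qed

lemma trig_poly_norm:
  assumes "finite F"
  shows "(L2_norm (trig_poly a F))\<^sup>2 = (\<Sum>k\<in>F. (cmod (a k))\<^sup>2)"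
proof -
  have "complex_of_real ((L2_norm (trig_poly a F))\<^sup>2) = (\<Sum>k\<in>F. a k * cnj (a k))"
    unfolding L2_inner_self[symmetric]
    by (simp add: trig_poly_inner trig_poly_square_integrable fourier_coeff_trig_poly assms)
  also have "\<dots> = of_real (\<Sum>k\<in>F. (cmod (a k))\<^sup>2)"
    by (simp add: complex_norm_square[symmetric] del: of_real_power)
  finally show ?thesis by (simp only: of_real_eq_iff)
qed

text \<open>
  The square of the distance from \<open>f\<close> to its partial Fourier sum is the difference of the two
  sides.
\<close>
lemma Bessel_inequality:
  assumes f: "square_integrable torus f" and "finite F"
  shows "(\<Sum>k\<in>F. (cmod (fourier_coeff f k))\<^sup>2) \<le> (L2_norm f)\<^sup>2"
proof -
  let ?p = "trig_poly (fourier_coeff f) F" and ?S = "\<Sum>k\<in>F. (cmod (fourier_coeff f k))\<^sup>2"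
  have p: "square_integrable torus ?p" by (rule trig_poly_square_integrable)
  have pf: "L2_inner ?p f = of_real ?S"
    by (simp add: trig_poly_inner f complex_norm_square[symmetric] del: of_real_power)
  have fp: "L2_inner f ?p = of_real ?S"
    by (subst L2_inner_commute) (simp only: pf complex_cnj_complex_of_real)
  have d: "square_integrable torus (\<lambda>x. f x - ?p x)"
    using f p by (rule square_integrable_diff)
  have "complex_of_real ((L2_norm (\<lambda>x. f x - ?p x))\<^sup>2)
      = L2_inner f f - L2_inner f ?p - (L2_inner ?p f - L2_inner ?p ?p)"
    unfolding L2_inner_self[of "\<lambda>x. f x - ?p x", symmetric]
    by (simp only: L2_inner_diff_left[OF f p d] L2_inner_diff_right[OF f p f] L2_inner_diff_right[OF f p p])
  also have "\<dots> = of_real ((L2_norm f)\<^sup>2 - ?S)"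
    by (simp only: pf fp L2_inner_self trig_poly_norm[OF assms(2)] of_real_diff) simp
  finally have "(L2_norm (\<lambda>x. f x - ?p x))\<^sup>2 = (L2_norm f)\<^sup>2 - ?S"
    by (simp only: of_real_eq_iff)
  then show ?thesis by (smt (verit) zero_le_power2)
qed

section \<open>The Riesz-Fischer theorem\<close>

lemma nn_integral_square:
  "square_integrable torus f \<Longrightarrow> (\<integral>\<^sup>+x. ennreal ((cmod (f x))\<^sup>2) \<partial>torus) = ennreal ((L2_norm f)\<^sup>2)"
  unfolding L2_norm_sq by (rule nn_integral_eq_integral) (auto simp: square_integrable_def)

lemma L2_norm_diff_square_le:
  assumes "square_integrable torus f" "square_integrable torus g"
  shows "(L2_norm (\<lambda>x. f x - g x))\<^sup>2 \<le> 2 * (L2_norm f)\<^sup>2 + 2 * (L2_norm g)\<^sup>2"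
proof -
  have int: "integrable torus (\<lambda>x. (cmod (f x))\<^sup>2)" "integrable torus (\<lambda>x. (cmod (g x))\<^sup>2)"
    "integrable torus (\<lambda>x. (cmod (f x - g x))\<^sup>2)"
    using assms square_integrable_diff[OF assms] by (auto simp: square_integrable_def)
  have "(LINT x|torus. (cmod (f x - g x))\<^sup>2) \<le> (LINT x|torus. 2 * (cmod (f x))\<^sup>2 + 2 * (cmod (g x))\<^sup>2)"
    by (rule integral_mono) (use int cmod_diff_square_le in auto)
  then show ?thesis using int by (simp add: L2_norm_sq)
qed

lemma trig_poly_diff:
  assumes "finite G" "F \<subseteq> G"
  shows "trig_poly a G x - trig_poly a F x = trig_poly a (G - F) x"
  using assms by (simp add: trig_poly_def sum_diff)

text \<open>
  By orthonormality the square of the distance is the sum of \<open>|a\<^sub>k|\<^sup>2\<close> over \<open>G - F\<close>, which is part of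
  the tail of a convergent series.
\<close>
lemma trig_poly_Cauchy:
  assumes "(\<lambda>k. (cmod (a k))\<^sup>2) summable_on UNIV" "0 < \<epsilon>"
  obtains F0 where "finite F0"
    "\<And>F G. finite G \<Longrightarrow> F0 \<subseteq> F \<Longrightarrow> F \<subseteq> G \<Longrightarrow>
      (L2_norm (\<lambda>x. trig_poly a G x - trig_poly a F x))\<^sup>2 \<le> \<epsilon>"
proof -
  let ?A = "\<lambda>k. (cmod (a k))\<^sup>2"
  obtain S where S: "(?A has_sum S) UNIV" using assms(1) by (auto simp: summable_on_def)
  then have "eventually (\<lambda>F. dist (sum ?A F) S < \<epsilon>) (finite_subsets_at_top UNIV)"
    using assms(2) unfolding has_sum_def tendsto_iff by blast
  then obtain F0 where F0: "finite F0" "\<And>F. finite F \<Longrightarrow> F0 \<subseteq> F \<Longrightarrow> dist (sum ?A F) S < \<epsilon>"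
    by (auto simp: eventually_finite_subsets_at_top)
  have "(L2_norm (\<lambda>x. trig_poly a G x - trig_poly a F x))\<^sup>2 \<le> \<epsilon>"
    if FG: "finite G" "F0 \<subseteq> F" "F \<subseteq> G" for F G
  proof -
    have "(L2_norm (\<lambda>x. trig_poly a G x - trig_poly a F x))\<^sup>2 = sum ?A (G - F)"
      using FG by (simp add: trig_poly_diff trig_poly_norm[of "G - F" a, symmetric])
    also have "\<dots> = sum ?A G - sum ?A F"
      using FG by (intro sum_diff) auto
    also have "\<dots> \<le> S - sum ?A F"
      using finite_sum_le_has_sum[OF S FG(1)] by simp
    also have "\<dots> \<le> \<epsilon>"
      using F0(2)[of F] FG finite_subset by (fastforce simp: dist_real_def)
    finally show ?thesis .
  qed
  then show thesis by (rule that[OF F0(1)])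
qed

text \<open>
  Along a sequence \<open>S\<close> of partial sums with \<open>\<parallel>S (n+1) - S n\<parallel>\<^sup>2 \<le> 4\<^bsup>-n\<^esup>\<close> the increments are summable
  in \<open>L\<^sup>1\<close>, so \<open>S n\<close> converges almost everywhere, and by Fatou's lemma the pointwise limit is also
  the limit in \<open>L\<^sup>2\<close>. The limit is periodic at every point, because whether the sequence converges
  and what its limit is depend only on its values there, which are periodic.
\<close>
theorem Riesz_Fischer:
  assumes a: "(\<lambda>k. (cmod (a k))\<^sup>2) summable_on UNIV"
  obtains v where "v \<in> L2_torus"
    "((\<lambda>F. L2_norm (\<lambda>x. v x - trig_poly a F x)) \<longlongrightarrow> 0) (finite_subsets_at_top UNIV)"
proof -
  have "\<exists>F0. finite F0 \<and> (\<forall>F G. finite G \<longrightarrow> F0 \<subseteq> F \<longrightarrow> F \<subseteq> G \<longrightarrow>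
      (L2_norm (\<lambda>x. trig_poly a G x - trig_poly a F x))\<^sup>2 \<le> (1/4) ^ n)" for n :: nat
    by (rule trig_poly_Cauchy[OF a, of "(1/4) ^ n"]) auto
  then obtain E where E: "\<And>n. finite (E n)"
    "\<And>n F G. finite G \<Longrightarrow> E n \<subseteq> F \<Longrightarrow> F \<subseteq> G \<Longrightarrow>
      (L2_norm (\<lambda>x. trig_poly a G x - trig_poly a F x))\<^sup>2 \<le> (1/4) ^ n"
    by metis
  define F where "F n = (\<Union>i\<le>n. E i)" for n
  have finF: "finite (F n)" for n using E(1) by (simp add: F_def)
  have EF: "E n \<subseteq> F n" for n by (auto simp: F_def)
  have monoF: "F m \<subseteq> F n" if "m \<le> n" for m n using that by (force simp: F_def)
  define S where "S n = trig_poly a (F n)" for n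
  have S: "square_integrable torus (S n)" for n
    unfolding S_def by (rule trig_poly_square_integrable)
  have [measurable]: "S n \<in> borel_measurable torus" for n
    using S by (rule square_integrable_measurable)
  have close: "(L2_norm (\<lambda>x. S n x - S m x))\<^sup>2 \<le> (1/4) ^ m" if "m \<le> n" for m n
    unfolding S_def by (rule E(2)[OF finF EF monoF[OF that]])
  define D where "D n x = S (Suc n) x - S n x" for n x
  have D: "square_integrable torus (D n)" for n
    unfolding D_def[abs_def] by (rule square_integrable_diff[OF S S])
  have [measurable]: "D n \<in> borel_measurable torus" for n
    using D by (rule square_integrable_measurable)
  \<comment> \<open>Weighting \<open>|D n|\<^sup>2\<close> by \<open>2 ^ n\<close> in \<open>pt\<close> balances the decay \<open>4\<^bsup>-n\<^esup>\<close> of its integral.\<close>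
  have D_int: "(\<integral>\<^sup>+x. ennreal (cmod (D n x)) \<partial>torus) \<le> ennreal (2 * (1/2) ^ n)" for n
  proof -
    have pt: "t \<le> 2 ^ n * t\<^sup>2 + (1/2) ^ n" if "0 \<le> t" for t :: real
    proof -
      have "0 \<le> (2 ^ n * t - 1)\<^sup>2" by simp
      then have "2 * (2 ^ n * t) \<le> 2 ^ n * (2 ^ n * t\<^sup>2) + 1"
        by (simp add: power2_eq_square algebra_simps)
      then have "2 ^ n * t \<le> 2 ^ n * (2 ^ n * t\<^sup>2) + 1"
        by (rule order_trans[rotated]) (use that in simp)
      also have "\<dots> = 2 ^ n * (2 ^ n * t\<^sup>2 + (1/2) ^ n)"
        by (simp add: distrib_left flip: power_mult_distrib)
      finally show ?thesis by simp
    qed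
    have "(\<integral>\<^sup>+x. ennreal (cmod (D n x)) \<partial>torus)
        \<le> (\<integral>\<^sup>+x. ennreal (2 ^ n) * ennreal ((cmod (D n x))\<^sup>2) + ennreal ((1/2) ^ n) \<partial>torus)"
      by (rule nn_integral_mono)
         (use pt in \<open>simp add: ennreal_mult'[symmetric] ennreal_plus[symmetric] del: ennreal_plus\<close>)
    also have "\<dots> = ennreal (2 ^ n) * ennreal ((L2_norm (D n))\<^sup>2) + ennreal ((1/2) ^ n)"
      by (simp add: nn_integral_add nn_integral_cmult nn_integral_square[OF D] emeasure_torus_UNIV)
    also have "\<dots> = ennreal (2 ^ n * (L2_norm (D n))\<^sup>2 + (1/2) ^ n)"
      by (simp add: ennreal_mult'[symmetric] ennreal_plus[symmetric] del: ennreal_plus)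
    also have "\<dots> \<le> ennreal (2 ^ n * (1/4) ^ n + (1/2) ^ n)"
      using close[of n "Suc n"] by (intro ennreal_leI add_right_mono mult_left_mono) (auto simp: D_def[abs_def])
    also have "2 ^ n * (1/4) ^ n + (1/2) ^ n = (2 * (1/2) ^ n :: real)"
      by (simp flip: power_mult_distrib)
    finally show ?thesis .
  qed
  have "(\<integral>\<^sup>+x. (\<Sum>n. ennreal (cmod (D n x))) \<partial>torus) = (\<Sum>n. \<integral>\<^sup>+x. ennreal (cmod (D n x)) \<partial>torus)"
    by (rule nn_integral_suminf) measurable
  also have "\<dots> \<le> (\<Sum>n. ennreal (2 * (1/2) ^ n))"
    by (intro suminf_le D_int) auto
  also have "\<dots> = ennreal (\<Sum>n. 2 * (1/2) ^ n)"
    by (rule suminf_ennreal2) (auto intro: summable_mult summable_geometric)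
  also have "\<dots> < \<infinity>" by simp
  finally have "AE x in torus. (\<Sum>n. ennreal (cmod (D n x))) \<noteq> \<infinity>"
    by (intro nn_integral_noteq_infinite) auto
  then have conv: "AE x in torus. (\<lambda>n. S n x) \<longlonglongrightarrow> lim (\<lambda>n. S n x)"
  proof eventually_elim
    case (elim x)
    then have "summable (\<lambda>n. cmod (D n x))"
      by (intro summable_suminf_not_top) auto
    then have "summable (\<lambda>n. D n x)" by (rule summable_norm_cancel)
    then have "(\<lambda>n. S 0 x + (\<Sum>i<n. D i x)) \<longlonglongrightarrow> S 0 x + (\<Sum>n. D n x)"
      by (intro tendsto_intros summable_LIMSEQ)
    moreover have "S 0 x + (\<Sum>i<n. D i x) = S n x" for n
      unfolding D_def by (simp add: sum_lessThan_telescope[of "\<lambda>i. S i x"])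
    ultimately have "convergent (\<lambda>n. S n x)" by (auto simp: convergent_def)
    then show ?case by (simp add: convergent_LIMSEQ_iff)
  qed
  define v where "v x = lim (\<lambda>n. S n x)" for x
  have [measurable]: "v \<in> borel_measurable torus"
    unfolding v_def[abs_def] by measurable
  have vS_nn: "(\<integral>\<^sup>+x. ennreal ((cmod (v x - S m x))\<^sup>2) \<partial>torus) \<le> ennreal ((1/4) ^ m)" for m
  proof -
    have "AE x in torus. ennreal ((cmod (v x - S m x))\<^sup>2)
        = liminf (\<lambda>n. ennreal ((cmod (S n x - S m x))\<^sup>2))"
      using conv
    proof eventually_elim
      case (elim x)
      then have "(\<lambda>n. ennreal ((cmod (S n x - S m x))\<^sup>2)) \<longlonglongrightarrow> ennreal ((cmod (v x - S m x))\<^sup>2)"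
        unfolding v_def by (intro tendsto_intros)
      from lim_imp_Liminf[OF _ this] show ?case by simp
    qed
    then have "(\<integral>\<^sup>+x. ennreal ((cmod (v x - S m x))\<^sup>2) \<partial>torus)
        = (\<integral>\<^sup>+x. liminf (\<lambda>n. ennreal ((cmod (S n x - S m x))\<^sup>2)) \<partial>torus)"
      by (rule nn_integral_cong_AE)
    also have "\<dots> \<le> liminf (\<lambda>n. \<integral>\<^sup>+x. ennreal ((cmod (S n x - S m x))\<^sup>2) \<partial>torus)"
      by (rule nn_integral_liminf) measurable
    also have "\<dots> \<le> liminf (\<lambda>n. ennreal ((1/4) ^ m))"
    proof (rule Liminf_mono)
      show "\<forall>\<^sub>F n in sequentially. (\<integral>\<^sup>+x. ennreal ((cmod (S n x - S m x))\<^sup>2) \<partial>torus) \<le> ennreal ((1/4) ^ m)"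
        using eventually_ge_at_top[of m]
      proof eventually_elim
        case (elim n)
        then show ?case
          using close nn_integral_square[OF square_integrable_diff[OF S S]] by (simp add: ennreal_leI)
      qed
    qed
    also have "\<dots> = ennreal ((1/4) ^ m)" by (rule Liminf_const) simp
    finally show ?thesis .
  qed
  have vS: "square_integrable torus (\<lambda>x. v x - S m x)" for m
    unfolding square_integrable_def
  proof
    show "integrable torus (\<lambda>x. (cmod (v x - S m x))\<^sup>2)"
      by (rule integrableI_nonneg)
         (use vS_nn[of m] in \<open>auto intro: le_less_trans[OF _ ennreal_less_top]\<close>)
  qed measurable
  have vS_norm: "(L2_norm (\<lambda>x. v x - S m x))\<^sup>2 \<le> (1/4) ^ m" for m
    using vS_nn[of m] nn_integral_square[OF vS] by simp
  have v_int: "square_integrable torus v"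
    using square_integrable_add[OF vS S, of 0 0] by simp
  have "torus_periodic v"
    using trig_poly_periodic[of a, unfolded torus_periodic_def]
    unfolding torus_periodic_def v_def S_def by simp
  with v_int have "v \<in> L2_torus" by (simp add: L2_torus_iff)
  moreover have "((\<lambda>G. L2_norm (\<lambda>x. v x - trig_poly a G x)) \<longlongrightarrow> 0) (finite_subsets_at_top UNIV)"
    unfolding tendsto_iff
  proof (intro allI impI)
    fix e :: real assume "0 < e"
    have "(\<lambda>m. 4 * (1/4 :: real) ^ m) \<longlonglongrightarrow> 4 * 0"
      by (intro tendsto_intros LIMSEQ_realpow_zero) auto
    from order_tendstoD(2)[OF this, of "e\<^sup>2"]
    have "\<forall>\<^sub>F m in sequentially. 4 * (1/4 :: real) ^ m < e\<^sup>2"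
      using \<open>0 < e\<close> by simp
    then obtain m where m: "4 * (1/4 :: real) ^ m < e\<^sup>2"
      by (auto simp: eventually_sequentially)
    have "L2_norm (\<lambda>x. v x - trig_poly a G x) < e" if G: "finite G" "F m \<subseteq> G" for G
    proof -
      have GS: "square_integrable torus (\<lambda>x. trig_poly a G x - S m x)"
        by (intro square_integrable_diff trig_poly_square_integrable S)
      have "(L2_norm (\<lambda>x. v x - trig_poly a G x))\<^sup>2
          = (L2_norm (\<lambda>x. (v x - S m x) - (trig_poly a G x - S m x)))\<^sup>2" by simp
      also have "\<dots> \<le> 2 * (L2_norm (\<lambda>x. v x - S m x))\<^sup>2 + 2 * (L2_norm (\<lambda>x. trig_poly a G x - S m x))\<^sup>2"
        by (rule L2_norm_diff_square_le[OF vS GS])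
      also have "\<dots> \<le> 2 * (1/4) ^ m + 2 * (1/4) ^ m"
        using vS_norm[of m] E(2)[OF G(1) EF G(2)] by (simp add: S_def)
      also have "\<dots> < e\<^sup>2" using m by simp
      finally show ?thesis by (rule power_less_imp_less_base) (use \<open>0 < e\<close> in simp)
    qed
    then show "\<forall>\<^sub>F G in finite_subsets_at_top UNIV. dist (L2_norm (\<lambda>x. v x - trig_poly a G x)) 0 < e"
      using finF[of m] by (auto simp: eventually_finite_subsets_at_top dist_real_def)
  qed
  ultimately show thesis by (rule that)
qed

section \<open>Space-time Fourier coefficients\<close>

text \<open>
  The finite partial sums are the inner products of \<open>trig_poly a F\<close> with \<open>w\<close>, and these converge
  by the Cauchy-Schwarz inequality.
\<close>
lemma has_sum_L2_inner:
  assumes v: "square_integrable torus v" and w: "square_integrable torus w"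
    and conv: "((\<lambda>F. L2_norm (\<lambda>x. v x - trig_poly a F x)) \<longlongrightarrow> 0) (finite_subsets_at_top UNIV)"
  shows "((\<lambda>k. a k * cnj (fourier_coeff w k)) has_sum L2_inner v w) UNIV"
proof -
  have "((\<lambda>F. L2_inner v w - (\<Sum>k\<in>F. a k * cnj (fourier_coeff w k))) \<longlongrightarrow> 0) (finite_subsets_at_top UNIV)"
  proof (rule Lim_null_comparison)
    show "((\<lambda>F. L2_norm (\<lambda>x. v x - trig_poly a F x) * L2_norm w) \<longlongrightarrow> 0) (finite_subsets_at_top UNIV)"
      using tendsto_mult_left_zero[OF conv] .
    show "\<forall>\<^sub>F F in finite_subsets_at_top UNIV.
        norm (L2_inner v w - (\<Sum>k\<in>F. a k * cnj (fourier_coeff w k)))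
          \<le> L2_norm (\<lambda>x. v x - trig_poly a F x) * L2_norm w"
    proof (rule always_eventually, rule allI)
      fix F
      have p: "square_integrable torus (trig_poly a F)" by (rule trig_poly_square_integrable)
      show "norm (L2_inner v w - (\<Sum>k\<in>F. a k * cnj (fourier_coeff w k)))
          \<le> L2_norm (\<lambda>x. v x - trig_poly a F x) * L2_norm w"
        using L2_inner_le[OF square_integrable_diff[OF v p] w]
        by (simp add: L2_inner_diff_left[OF v p w] trig_poly_inner[OF w])
    qed
  qed
  from tendsto_diff[OF tendsto_const[of "L2_inner v w"] this] show ?thesis
    by (simp add: has_sum_def)
qed

lemma fourier_coeff_L2_limit:
  assumes v: "square_integrable torus v"
    and conv: "((\<lambda>F. L2_norm (\<lambda>x. v x - trig_poly a F x)) \<longlongrightarrow> 0) (finite_subsets_at_top UNIV)"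
  shows "fourier_coeff v j = a j"
proof -
  have "((\<lambda>k. a k * cnj (fourier_coeff (torus_char j) k)) has_sum fourier_coeff v j) UNIV"
    unfolding fourier_coeff_eq_inner[of v]
    by (rule has_sum_L2_inner[OF v torus_char_square_integrable conv])
  moreover have "((\<lambda>k. a k * cnj (fourier_coeff (torus_char j) k)) has_sum a j) UNIV"
    by (rule has_sum_finite_neutralI[of "{j}"])
       (auto simp: fourier_coeff_eq_inner torus_char_orthonormal)
  ultimately show ?thesis by (rule has_sum_unique)
qed

text \<open>
  The coefficient of \<open>|v|\<^sup>2\<close> at \<open>l\<close> is the inner product of \<open>v\<close> with \<open>v\<close> times the character of
  \<open>l\<close>, and multiplication by a character shifts the Fourier coefficients.
\<close>
lemma has_sum_fourier_coeff_abs_square: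
  assumes v: "square_integrable torus v"
    and conv: "((\<lambda>F. L2_norm (\<lambda>x. v x - trig_poly a F x)) \<longlongrightarrow> 0) (finite_subsets_at_top UNIV)"
  shows "((\<lambda>k. a k * cnj (a (k - l))) has_sum fourier_coeff (\<lambda>x. of_real ((cmod (v x))\<^sup>2)) l) UNIV"
proof -
  define w where "w x = v x * torus_char l x" for x
  have w: "square_integrable torus w"
    unfolding w_def[abs_def] by (rule square_integrable_mult_bounded[OF v torus_char_measurable]) simp
  have "fourier_coeff w k = fourier_coeff v (k - l)" for k
  proof -
    have "torus_char l x * cnj (torus_char k x) = cnj (torus_char (k - l) x)" for x
      by (simp add: torus_char_diff[symmetric] mult.commute)
    then show ?thesis
      by (simp add: fourier_coeff_eq_inner L2_inner_def w_def mult.assoc)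
  qed
  then have coeff: "fourier_coeff w k = a (k - l)" for k
    using fourier_coeff_L2_limit[OF v conv] by simp
  have "L2_inner v w = fourier_coeff (\<lambda>x. of_real ((cmod (v x))\<^sup>2)) l"
    by (simp add: fourier_coeff_eq_inner L2_inner_def w_def complex_norm_square mult.assoc
        del: of_real_power)
  with has_sum_L2_inner[OF v w conv] show ?thesis by (simp add: coeff)
qed

lemma summable_shifted_product:
  fixes a :: "'c::ab_group_add \<Rightarrow> complex"
  assumes "(\<lambda>k. (cmod (a k))\<^sup>2) summable_on UNIV"
  shows "(\<lambda>k. cmod (a k * cnj (a (k - l)))) summable_on UNIV"
proof -
  have "bij_betw (\<lambda>k. k - l) UNIV UNIV"
    by (rule bij_betwI[of _ _ _ "\<lambda>k. k + l"]) auto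
  from summable_on_reindex_bij_betw[OF this, of "\<lambda>k. (cmod (a k))\<^sup>2"] assms
  have "(\<lambda>k. (cmod (a (k - l)))\<^sup>2) summable_on UNIV" by simp
  from summable_on_add[OF assms this]
  show ?thesis
  proof (rule summable_on_comparison_test)
    fix k
    have "2 * (cmod (a k) * cmod (a (k - l))) \<le> (cmod (a k))\<^sup>2 + (cmod (a (k - l)))\<^sup>2"
      using sum_squares_bound[of "cmod (a k)" "cmod (a (k - l))"] by (simp only: mult.assoc)
    moreover have "0 \<le> cmod (a k) * cmod (a (k - l))" by simp
    ultimately show "cmod (a k * cnj (a (k - l))) \<le> (cmod (a k))\<^sup>2 + (cmod (a (k - l)))\<^sup>2"
      unfolding norm_mult complex_mod_cnj by linarith
  qed simp
qed

text \<open>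
  The series converges uniformly in \<open>t\<close>, so it is integrated term by term, and the integral over
  a period keeps exactly the terms of frequency \<open>s\<close>.
\<close>
lemma has_sum_time_coeff:
  fixes c :: "'k \<Rightarrow> complex" and n :: "'k \<Rightarrow> int"
  assumes c: "(\<lambda>k. cmod (c k)) summable_on UNIV"
    and f: "\<And>t. ((\<lambda>k. c k * cis (of_int (n k) * t)) has_sum f t) UNIV"
  shows "((\<lambda>k. if n k = s then c k else 0) has_sum (LINT t|torus. f t * cis (- (of_int s * t)))) UNIV"
proof -
  define g where "g k t = c k * cis (of_int (n k - s) * t)" for k and t :: real
  define h where "h t = f t * cis (- (of_int s * t))" for t
  have g_h: "((\<lambda>k. g k t) has_sum h t) UNIV" for t
  proof -
    have "g k t = c k * cis (of_int (n k) * t) * cis (- (of_int s * t))" for k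
      by (simp add: g_def cis_mult mult.assoc left_diff_distrib)
    with has_sum_cmult_left[OF f[of t], of "cis (- (of_int s * t))"] show ?thesis
      by (simp add: h_def)
  qed
  have unif: "uniform_limit UNIV (\<lambda>F t. \<Sum>k\<in>F. g k t) h (finite_subsets_at_top UNIV)"
    by (rule Weierstrass_m_test_general'[OF _ _ c]) (use g_h in \<open>auto simp: g_def norm_mult\<close>)
  have cont_g: "continuous_on UNIV (\<lambda>t. \<Sum>k\<in>F. g k t)" for F
    unfolding g_def by (intro continuous_intros)
  have cont_h: "continuous_on UNIV h"
    by (rule uniform_limit_theorem[OF _ unif]) (use cont_g in auto)
  have bound_h: "cmod (h t) \<le> (\<Sum>\<^sub>\<infinity>k. cmod (c k))" for t
    by (rule norm_infsum_le[OF g_h has_sum_infsum[OF c]]) (simp add: g_def norm_mult)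
  have bound_g: "cmod (\<Sum>k\<in>F. g k t) \<le> (\<Sum>k\<in>F. cmod (c k))" for F t
    by (rule order_trans[OF norm_sum]) (simp add: g_def norm_mult)
  have int_h: "integrable torus h"
    by (rule torus.integrable_const_bound[of _ "\<Sum>\<^sub>\<infinity>k. cmod (c k)"])
       (use bound_h borel_imp_measurable_torus[OF borel_measurable_continuous_onI[OF cont_h]] in auto)
  have int_g: "integrable torus (\<lambda>t. \<Sum>k\<in>F. g k t)" for F
    by (rule torus.integrable_const_bound[of _ "\<Sum>k\<in>F. cmod (c k)"])
       (use bound_g borel_imp_measurable_torus[OF borel_measurable_continuous_onI[OF cont_g]] in auto)
  have g1: "integrable torus (g k)" for k
    using int_g[of "{k}"] by simp
  have "(LINT t|torus. g k t) = (if n k = s then c k else 0)" for k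
    by (simp add: g_def integral_torus_cis_real del: of_int_diff)
  then have sum_g: "(LINT t|torus. (\<Sum>k\<in>F. g k t)) = (\<Sum>k\<in>F. if n k = s then c k else 0)" for F
    using g1 by simp
  have "((\<lambda>F. \<Sum>k\<in>F. if n k = s then c k else 0) \<longlongrightarrow> (LINT t|torus. h t)) (finite_subsets_at_top UNIV)"
    unfolding tendsto_iff
  proof (intro allI impI)
    fix e :: real assume "0 < e"
    with unif have "\<forall>\<^sub>F F in finite_subsets_at_top UNIV. \<forall>t\<in>UNIV. dist (\<Sum>k\<in>F. g k t) (h t) < e / 2"
      by (intro uniform_limitD) auto
    then show "\<forall>\<^sub>F F in finite_subsets_at_top UNIV.
        dist (\<Sum>k\<in>F. if n k = s then c k else 0) (LINT t|torus. h t) < e"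
    proof eventually_elim
      case (elim F)
      have "dist (\<Sum>k\<in>F. if n k = s then c k else 0) (LINT t|torus. h t)
          = cmod (LINT t|torus. (\<Sum>k\<in>F. g k t) - h t)"
        unfolding dist_norm sum_g[symmetric] using int_g int_h by simp
      also have "\<dots> \<le> (LINT t|torus. cmod ((\<Sum>k\<in>F. g k t) - h t))"
        by (rule integral_norm_bound)
      also have "\<dots> \<le> (LINT t|(torus :: real measure). e / 2)"
        by (rule integral_mono) (use elim int_g int_h in \<open>auto simp: dist_norm less_imp_le\<close>)
      also have "\<dots> < e" using \<open>0 < e\<close> by simp
      finally show ?case .
    qed
  qed
  then show ?thesis by (simp add: has_sum_def h_def)
qed

lemma summable_fourier_coeff_square:
  assumes "square_integrable torus u"
  shows "(\<lambda>k. (cmod (fourier_coeff u k))\<^sup>2) summable_on UNIV"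
  by (rule nonneg_bdd_above_summable_on)
     (use Bessel_inequality[OF assms] in \<open>auto intro!: bdd_aboveI[of _ "(L2_norm u)\<^sup>2"]\<close>)

lemma schroedinger_flow_L2_limit:
  assumes "u \<in> L2_torus"
  defines "a \<equiv> \<lambda>t k. fourier_coeff u k * cis (- (of_int (freq_norm_sq k) * t))"
  shows "square_integrable torus (schroedinger_flow t u)"
    and "((\<lambda>F. L2_norm (\<lambda>x. schroedinger_flow t u x - trig_poly (a t) F x)) \<longlongrightarrow> 0)
      (finite_subsets_at_top UNIV)"
proof -
  have poly: "(\<Sum>k\<in>F. fourier_coeff u k * cis (freq_inner k x - of_int (freq_norm_sq k) * t)) = trig_poly (a t) F x"
    for F x
    by (simp add: trig_poly_def a_def torus_char_def mult.assoc cis_mult)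
  have "(\<lambda>k. (cmod (a t k))\<^sup>2) summable_on UNIV"
    using summable_fourier_coeff_square[of u] assms(1)
    by (simp add: a_def norm_mult L2_torus_iff)
  then obtain v where v: "v \<in> L2_torus"
    "((\<lambda>F. L2_norm (\<lambda>x. v x - trig_poly (a t) F x)) \<longlongrightarrow> 0) (finite_subsets_at_top UNIV)"
    by (rule Riesz_Fischer)
  define is_limit where "is_limit w \<longleftrightarrow> w \<in> L2_torus \<and>
      ((\<lambda>F. L2_norm (\<lambda>x. w x - trig_poly (a t) F x)) \<longlongrightarrow> 0) (finite_subsets_at_top UNIV)" for w
  have "is_limit v" using v by (simp add: is_limit_def)
  moreover have "schroedinger_flow t u = (SOME w. is_limit w)"
    by (simp only: schroedinger_flow_def poly is_limit_def)
  ultimately have "is_limit (schroedinger_flow t u)"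
    by (simp only: someI[of is_limit v])
  then show "square_integrable torus (schroedinger_flow t u)"
    "((\<lambda>F. L2_norm (\<lambda>x. schroedinger_flow t u x - trig_poly (a t) F x)) \<longlongrightarrow> 0)
      (finite_subsets_at_top UNIV)"
    by (simp_all add: is_limit_def L2_torus_iff)
qed

text \<open>
  The phases of \<open>a\<^sub>k\<close> and of the conjugate of \<open>a\<^bsub>k-l\<^esub>\<close> at time \<open>t\<close> combine to the time frequency
  \<open>|k - l|\<^sup>2 - |k|\<^sup>2\<close>.
\<close>
theorem has_sum_spacetime_coeff:
  assumes u: "u \<in> L2_torus"
  shows "((\<lambda>k. if freq_norm_sq (k - l) - freq_norm_sq k = s
      then fourier_coeff u k * cnj (fourier_coeff u (k - l)) else 0)
    has_sum spacetime_coeff u (l, s)) UNIV"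
proof -
  define a where "a t k = fourier_coeff u k * cis (- (of_int (freq_norm_sq k) * t))" for t k
  let ?n = "\<lambda>k. freq_norm_sq (k - l) - freq_norm_sq k"
  have prod: "a t k * cnj (a t (k - l))
      = fourier_coeff u k * cnj (fourier_coeff u (k - l)) * cis (of_int (?n k) * t)" for t k
  proof -
    have "cis (- (of_int (freq_norm_sq k) * t)) * cis (of_int (freq_norm_sq (k - l)) * t) = cis (of_int (?n k) * t)"
      by (simp add: cis_mult left_diff_distrib)
    then show ?thesis by (simp add: a_def cis_cnj mult_ac)
  qed
  have "((\<lambda>k. fourier_coeff u k * cnj (fourier_coeff u (k - l)) * cis (of_int (?n k) * t))
      has_sum fourier_coeff (\<lambda>x. of_real ((cmod (schroedinger_flow t u x))\<^sup>2)) l) UNIV" for t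
    using has_sum_fourier_coeff_abs_square[OF schroedinger_flow_L2_limit[OF u, of t], folded a_def, of l]
    by (simp only: prod)
  from has_sum_time_coeff[OF summable_shifted_product[OF summable_fourier_coeff_square] this, of s]
  show ?thesis using u by (simp add: spacetime_coeff_def L2_torus_iff)
qed

section \<open>The space-time estimate\<close>

text \<open>
  For the partial sums over finitely many frequencies \<open>k\<close> this is \<open>sum_resonant_le\<close>, with a
  bound that does not depend on their number.
\<close>
lemma spacetime_coeff_power_sum_le:
  fixes u :: "real ^ 'd::finite \<Rightarrow> complex"
  assumes u: "u \<in> L2_torus" and P: "finite P"
  shows "(\<Sum>p\<in>P. cmod (spacetime_coeff u p) ^ Suc CARD('d))
    \<le> (real CARD('d) + 1) * ((L2_norm u)\<^sup>2) ^ Suc CARD('d)"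
proof -
  define A where "A k = cmod (fourier_coeff u k)" for k
  define c where "c l s k = (if freq_norm_sq (k - l) - freq_norm_sq k = s
      then fourier_coeff u k * cnj (fourier_coeff u (k - l)) else 0)" for l s k
  have lim: "((\<lambda>F. \<Sum>(l, s)\<in>P. cmod (sum (c l s) F) ^ Suc CARD('d))
      \<longlongrightarrow> (\<Sum>(l, s)\<in>P. cmod (spacetime_coeff u (l, s)) ^ Suc CARD('d))) (finite_subsets_at_top UNIV)"
    using has_sum_spacetime_coeff[OF u] unfolding has_sum_def c_def[symmetric]
    by (auto intro!: tendsto_intros simp del: power_Suc split: prod.split)
  have "\<forall>\<^sub>F F in finite_subsets_at_top UNIV. (\<Sum>(l, s)\<in>P. cmod (sum (c l s) F) ^ Suc CARD('d))
      \<le> (real CARD('d) + 1) * ((L2_norm u)\<^sup>2) ^ Suc CARD('d)"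
  proof (rule eventually_finite_subsets_at_top_weakI)
    fix F :: "(int ^ 'd) set" assume F: "finite F"
    have "cmod (sum (c l s) F) \<le> (\<Sum>k\<in>resonant F l s. A k * A (k - l))" for l s
    proof -
      have "sum (c l s) F = (\<Sum>k\<in>resonant F l s. fourier_coeff u k * cnj (fourier_coeff u (k - l)))"
        unfolding c_def resonant_def by (rule sum.inter_filter[OF F, symmetric])
      then show ?thesis
        using norm_sum[of "\<lambda>k. fourier_coeff u k * cnj (fourier_coeff u (k - l))" "resonant F l s"]
        by (simp add: A_def norm_mult)
    qed
    then have "(\<Sum>(l, s)\<in>P. cmod (sum (c l s) F) ^ Suc CARD('d))
        \<le> (\<Sum>(l, s)\<in>P. (\<Sum>k\<in>resonant F l s. A k * A (k - l)) ^ Suc CARD('d))"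
      by (intro sum_mono) (auto intro!: power_mono simp del: power_Suc)
    also have "\<dots> \<le> (real CARD('d) + 1) * ((L2_norm u)\<^sup>2) ^ Suc CARD('d)"
      by (rule sum_resonant_le[OF F P])
         (use u Bessel_inequality in \<open>auto simp: A_def L2_torus_iff\<close>)
    finally show "(\<Sum>(l, s)\<in>P. cmod (sum (c l s) F) ^ Suc CARD('d))
      \<le> (real CARD('d) + 1) * ((L2_norm u)\<^sup>2) ^ Suc CARD('d)" .
  qed
  from tendsto_upperbound[OF lim this] show ?thesis by (simp add: split_def)
qed

theorem theorem1p1:
  "\<exists>C::real. C > 0 \<and>
     (\<forall>u :: real ^ 'd::finite \<Rightarrow> complex. u \<in> L2_torus \<longrightarrow>
        lp_summable (real CARD('d) + 1) (spacetime_coeff u) \<and>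
        lp_norm (real CARD('d) + 1) (spacetime_coeff u) \<le> C * (L2_norm u)\<^sup>2)"
proof (intro exI conjI allI impI)
  define p where "p = real CARD('d) + 1"
  have p: "0 < p" and p_Suc: "p = real (Suc CARD('d))" by (simp_all add: p_def)
  show "0 < p powr (1 / p)" using p by simp
  fix u :: "real ^ 'd \<Rightarrow> complex" assume u: "u \<in> L2_torus"
  define B where "B = p * ((L2_norm u)\<^sup>2) ^ Suc CARD('d)"
  have powr: "x powr p = x ^ Suc CARD('d)" if "0 \<le> x" for x
    unfolding p_Suc by (rule powr_realpow') (use that in auto)
  have bound: "(\<Sum>q\<in>P. cmod (spacetime_coeff u q) powr p) \<le> B" if "finite P" for P
    using spacetime_coeff_power_sum_le[OF u that] by (simp add: powr B_def p_def[symmetric] del: power_Suc)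
  have summable: "(\<lambda>q. cmod (spacetime_coeff u q) powr p) summable_on UNIV"
    by (rule nonneg_bdd_above_summable_on) (use bound in \<open>auto intro!: bdd_aboveI[of _ B]\<close>)
  then show "lp_summable (real CARD('d) + 1) (spacetime_coeff u)"
    by (simp add: lp_summable_def p_def)
  have "(\<Sum>\<^sub>\<infinity>q. cmod (spacetime_coeff u q) powr p) \<le> B"
    by (rule infsum_le_finite_sums[OF summable]) (use bound in auto)
  then have "lp_norm p (spacetime_coeff u) \<le> B powr (1 / p)"
    unfolding lp_norm_def using p by (intro powr_mono2) (auto intro: infsum_nonneg)
  also have "\<dots> = p powr (1 / p) * (((L2_norm u)\<^sup>2) powr p) powr (1 / p)"
    unfolding B_def using p by (subst powr[symmetric]) (auto simp: powr_mult)
  also have "\<dots> = p powr (1 / p) * (L2_norm u)\<^sup>2"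
    using p by (simp add: powr_powr)
  finally show "lp_norm (real CARD('d) + 1) (spacetime_coeff u) \<le> p powr (1 / p) * (L2_norm u)\<^sup>2"
    by (simp add: p_def)
qed

end
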